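(* Let $\sigma\in\mathcal C$. For $f\in\mathbf L_2(\Omega,\mathcal B,\mu_\sigma)$ define a function $\mathscr F_\sigma f$ on $\mathcal S_{\mathbb R^n}(\mathbb R)$ by $$(\mathscr F_\sigma f)(\psi)=\int_\Omega e^{-i\langle\omega,\psi\rangle}f(\omega)\,d\mu_\sigma(\omega),\qquad\psi\in\mathcal S_{\mathbb R^n}(\mathbb R).$$ Then $\mathscr F_\sigma$ is an isometry from $\mathbf L_2(\Omega,\mathcal B,\mu_\sigma)$ onto the reproducing kernel Hilbert space $\mathscr H(C_\sigma)$.
   Context: $\mathcal S_{\mathbb R^n}(\mathbb R)$ is the space of real-valued Schwartz functions on $\mathbb R^n$; $\Omega=\mathcal S'_{\mathbb R^n}(\mathbb R)$ is its dual, the space of real tempered distributions, with Borel sigma-algebra $\mathcal B$ and duality pairing $\langle\omega,\psi\rangle$. $\widehat\psi(u)=\int_{\mathbb R^n}e^{-iu\cdot x}\psi(x)\,dx$. $\mathcal C$ is the set of positive regular Borel measures $\sigma$ on $\mathbb R^n$ with $\int_{\mathbb R^n}\frac{d\sigma(u)}{(1+|u|^2)^p}<\infty$ for some $p\in\mathbb N$. For $\sigma\in\mathcal C$, $\mu_\sigma$ is the probability measure on $\Omega$ (given by the Bochner-Minlos theorem) with $\int_\Omega e^{i\langle\omega,\psi\rangle}d\mu_\sigma(\omega)=e^{-\frac12\|\widehat\psi\|^2_{\mathbf L_2(\sigma)}}$ for all $\psi\in\mathcal S_{\mathbb R^n}(\mathbb R)$. The $\mathbf L_2$ spaces are complex.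 $\mathscr H(C_\sigma)$ is the reproducing kernel Hilbert space of (complex-valued) functions on $\mathcal S_{\mathbb R^n}(\mathbb R)$ with positive definite kernel $(\phi,\psi)\mapsto C_\sigma(\phi-\psi)=e^{-\frac12\|\widehat\phi-\widehat\psi\|^2_{\mathbf L_2(\sigma)}}$, $\phi,\psi\in\mathcal S_{\mathbb R^n}(\mathbb R)$. *)

theory Defs
  imports "HOL-Probability.Probability"
begin
definition partial_deriv :: "'n::finite \<Rightarrow> (real^'n \<Rightarrow> real) \<Rightarrow> real^'n \<Rightarrow> real" where
  "partial_deriv i f x = frechet_derivative f (at x) (axis i 1)"

text \<open>Derivatives of higher order are indexed by finite lists of coordinates instead of
  multi-indices: \<open>iter_deriv [i, j] f\<close> is the derivative with respect to the j-th and then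
  the i-th coordinate.\<close>

definition iter_deriv :: "'n::finite list \<Rightarrow> (real^'n \<Rightarrow> real) \<Rightarrow> real^'n \<Rightarrow> real" where
  "iter_deriv is f = foldr partial_deriv is f"

definition smooth :: "(real^'n::finite \<Rightarrow> real) \<Rightarrow> bool" where
  "smooth f \<longleftrightarrow> (\<forall>is x. iter_deriv is f differentiable (at x))"

definition weighted_deriv ::
    "nat \<Rightarrow> 'n::finite list \<Rightarrow> (real^'n \<Rightarrow> real) \<Rightarrow> real^'n \<Rightarrow> real" where
  "weighted_deriv k is f x = (1 + (norm x)\<^sup>2) ^ k * iter_deriv is f x"

definition schwartz_fun :: "(real^'n::finite \<Rightarrow> real) \<Rightarrow> bool" where
  "schwartz_fun f \<longleftrightarrow> smooth f \<and> (\<forall>k is. bounded (range (weighted_deriv k is f)))"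

lemma iter_deriv_Nil [simp]: "iter_deriv [] f = f"
  and iter_deriv_Cons [simp]: "iter_deriv (i # is) f = partial_deriv i (iter_deriv is f)"
  by (simp_all add: iter_deriv_def)

lemma iter_deriv_zero: "iter_deriv is (\<lambda>x. 0) = (\<lambda>x. 0)"
  by (induction "is") (simp_all add: partial_deriv_def)

lemma schwartz_fun_zero: "schwartz_fun (\<lambda>x. 0)"
  by (auto simp: schwartz_fun_def smooth_def weighted_deriv_def iter_deriv_zero)

lemma iter_deriv_add:
  assumes "smooth f" "smooth g"
  shows "iter_deriv is (\<lambda>x. f x + g x) = (\<lambda>x. iter_deriv is f x + iter_deriv is g x)"
proof (induction "is")
  case (Cons i "is")
  have "frechet_derivative (\<lambda>x. iter_deriv is f x + iter_deriv is g x) (at x) =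
      (\<lambda>h. frechet_derivative (iter_deriv is f) (at x) h +
            frechet_derivative (iter_deriv is g) (at x) h)" for x
    using assms unfolding smooth_def
    by (intro frechet_derivative_at [symmetric] has_derivative_add)
       (auto simp: frechet_derivative_works [symmetric])
  then show ?case
    by (simp add: Cons.IH partial_deriv_def fun_eq_iff)
qed simp

lemma iter_deriv_scale:
  assumes "smooth f"
  shows "iter_deriv is (\<lambda>x. c * f x) = (\<lambda>x. c * iter_deriv is f x)"
proof (induction "is")
  case (Cons i "is")
  have "frechet_derivative (\<lambda>x. c * iter_deriv is f x) (at x) =
      (\<lambda>h. c * frechet_derivative (iter_deriv is f) (at x) h)" for x
    using assms unfolding smooth_def
    by (intro frechet_derivative_at [symmetric] has_derivative_mult_right)
       (auto simp: frechet_derivative_works [symmetric])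
  then show ?case
    by (simp add: Cons.IH partial_deriv_def fun_eq_iff)
qed simp

lemma schwartz_fun_add:
  assumes "schwartz_fun f" "schwartz_fun g"
  shows "schwartz_fun (\<lambda>x. f x + g x)"
proof -
  have s: "smooth f" "smooth g"
    using assms by (auto simp: schwartz_fun_def)
  have "weighted_deriv k is (\<lambda>x. f x + g x) =
      (\<lambda>x. weighted_deriv k is f x + weighted_deriv k is g x)" for k "is"
    by (simp add: weighted_deriv_def iter_deriv_add [OF s] distrib_left fun_eq_iff)
  with assms s show ?thesis
    by (auto simp: schwartz_fun_def smooth_def iter_deriv_add intro!: bounded_plus_comp)
qed

lemma schwartz_fun_scale:
  assumes "schwartz_fun f"
  shows "schwartz_fun (\<lambda>x. c * f x)"
proof -
  have s: "smooth f"
    using assms by (auto simp: schwartz_fun_def)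
  have "weighted_deriv k is (\<lambda>x. c * f x) = (\<lambda>x. c *\<^sub>R weighted_deriv k is f x)" for k "is"
    by (simp add: weighted_deriv_def iter_deriv_scale [OF s] fun_eq_iff)
  moreover have "bounded (range (\<lambda>x. c *\<^sub>R weighted_deriv k is f x))" for k "is"
    using assms by (intro bounded_scaleR_comp) (auto simp: schwartz_fun_def)
  moreover have "smooth (\<lambda>x. c * f x)"
    using s by (auto simp: smooth_def iter_deriv_scale [OF s])
  ultimately show ?thesis
    by (simp only: schwartz_fun_def) simp
qed

typedef (overloaded) ('n::finite) schwartz = "{f :: real^'n \<Rightarrow> real. schwartz_fun f}"
  using schwartz_fun_zero by auto

setup_lifting type_definition_schwartz

lift_definition schwartz_apply :: "'n::finite schwartz \<Rightarrow> real^'n \<Rightarrow> real" is "\<lambda>f. f" .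

instantiation schwartz :: (finite) real_vector
begin

lift_definition zero_schwartz :: "'a schwartz" is "\<lambda>x. 0"
  by (rule schwartz_fun_zero)

lift_definition plus_schwartz :: "'a schwartz \<Rightarrow> 'a schwartz \<Rightarrow> 'a schwartz"
  is "\<lambda>f g x. f x + g x"
  by (rule schwartz_fun_add)

lift_definition scaleR_schwartz :: "real \<Rightarrow> 'a schwartz \<Rightarrow> 'a schwartz"
  is "\<lambda>c f x. c * f x"
  by (rule schwartz_fun_scale)

lift_definition uminus_schwartz :: "'a schwartz \<Rightarrow> 'a schwartz" is "\<lambda>f x. - f x"
  using schwartz_fun_scale [where c = "-1"] by auto

definition minus_schwartz :: "'a schwartz \<Rightarrow> 'a schwartz \<Rightarrow> 'a schwartz" where
  "minus_schwartz f g = f + - g"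

instance
  by standard
     ((simp add: minus_schwartz_def)?;
      transfer; auto simp: fun_eq_iff algebra_simps)+

end

definition schwartz_seminorm :: "nat \<Rightarrow> 'n::finite list \<Rightarrow> 'n schwartz \<Rightarrow> real" where
  "schwartz_seminorm k is f = (SUP x. \<bar>weighted_deriv k is (schwartz_apply f) x\<bar>)"

instantiation schwartz :: (finite) topological_space
begin

definition open_schwartz :: "'a schwartz set \<Rightarrow> bool" where
  "open_schwartz =
     generate_topology {{g. schwartz_seminorm k is (g - f) < e} | k is f e. e > 0}"

instance
  by standard (auto simp: open_schwartz_def intro: generate_topology.intros)

end

typedef (overloaded) ('n::finite) tempered_dist =
    "{T :: 'n schwartz \<Rightarrow> real. linear T \<and> continuous_on UNIV T}"
  morphisms pairing Abs_tempered_dist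
  by (rule exI [of _ "\<lambda>_. 0"]) (auto simp: linear_iff)

text \<open>The dual carries the weak-* topology. (The strong dual topology has the same Borel sets.)\<close>

instantiation tempered_dist :: (finite) topological_space
begin

definition open_tempered_dist :: "'a tempered_dist set \<Rightarrow> bool" where
  "open_tempered_dist = generate_topology {(\<lambda>\<omega>. pairing \<omega> \<psi>) -` U | \<psi> U. open U}"

instance
  by standard (auto simp: open_tempered_dist_def intro: generate_topology.intros)

end

text \<open>The elements of \<open>L2 M\<close> are representatives: two of them stand for the same element of
  the Hilbert space iff they agree almost everywhere.\<close>

definition L2 :: "'a measure \<Rightarrow> ('a \<Rightarrow> complex) set" where
  "L2 M = {f \<in> borel_measurable M. integrable M (\<lambda>x. (cmod (f x))\<^sup>2)}"

definition L2_norm :: "'a measure \<Rightarrow> ('a \<Rightarrow> complex) \<Rightarrow> real" where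
  "L2_norm M f = sqrt (\<integral>x. (cmod (f x))\<^sup>2 \<partial>M)"

definition fourier :: "'n::finite schwartz \<Rightarrow> real^'n \<Rightarrow> complex" where
  "fourier \<psi> u = (\<integral>x. exp (- \<i> * of_real (u \<bullet> x)) * of_real (schwartz_apply \<psi> x) \<partial>lborel)"

definition regular_borel :: "'a::topological_space measure \<Rightarrow> bool" where
  "regular_borel \<sigma> \<longleftrightarrow> sets \<sigma> = sets borel \<and>
     (\<forall>A \<in> sets borel.
        emeasure \<sigma> A = (INF U \<in> {U. open U \<and> A \<subseteq> U}. emeasure \<sigma> U) \<and>
        emeasure \<sigma> A = (SUP K \<in> {K. compact K \<and> K \<subseteq> A}. emeasure \<sigma> K))"

definition class_C :: "(real^'n::finite) measure set" where
  "class_C = {\<sigma>. regular_borel \<sigma> \<and>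
     (\<exists>p::nat. (\<integral>\<^sup>+ u. ennreal (1 / (1 + (norm u)\<^sup>2) ^ p) \<partial>\<sigma>) < \<infinity>)}"

definition C_fun :: "(real^'n::finite) measure \<Rightarrow> 'n schwartz \<Rightarrow> complex" where
  "C_fun \<sigma> \<psi> = of_real (exp (- (1/2) * (L2_norm \<sigma> (fourier \<psi>))\<^sup>2))"

text \<open>This determines \<open>\<mu>\<close> from \<open>\<sigma>\<close>; existence is the Bochner-Minlos theorem.\<close>

definition is_mu ::
    "(real^'n::finite) measure \<Rightarrow> 'n tempered_dist measure \<Rightarrow> bool" where
  "is_mu \<sigma> \<mu> \<longleftrightarrow> prob_space \<mu> \<and> sets \<mu> = sets borel \<and>
     (\<forall>\<psi>. (\<integral>\<omega>. exp (\<i> * of_real (pairing \<omega> \<psi>)) \<partial>\<mu>) = C_fun \<sigma> \<psi>)"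

definition F_transform ::
    "'n::finite tempered_dist measure \<Rightarrow> ('n tempered_dist \<Rightarrow> complex) \<Rightarrow> 'n schwartz \<Rightarrow> complex"
  where
  "F_transform \<mu> f \<psi> = (\<integral>\<omega>. exp (- \<i> * of_real (pairing \<omega> \<psi>)) * f \<omega> \<partial>\<mu>)"

locale function_hilbert_space =
  fixes H :: "('x \<Rightarrow> complex) set"
    and ip :: "('x \<Rightarrow> complex) \<Rightarrow> ('x \<Rightarrow> complex) \<Rightarrow> complex"
  assumes zero_mem: "(\<lambda>x. 0) \<in> H"
    and add_mem: "f \<in> H \<Longrightarrow> g \<in> H \<Longrightarrow> (\<lambda>x. f x + g x) \<in> H"
    and scale_mem: "f \<in> H \<Longrightarrow> (\<lambda>x. c * f x) \<in> H"
    and ip_add: "f \<in> H \<Longrightarrow> g \<in> H \<Longrightarrow> h \<in> H \<Longrightarrow> ip (\<lambda>x. f x + g x) h = ip f h + ip g h"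
    and ip_scale: "f \<in> H \<Longrightarrow> h \<in> H \<Longrightarrow> ip (\<lambda>x. c * f x) h = c * ip f h"
    and ip_cnj: "f \<in> H \<Longrightarrow> g \<in> H \<Longrightarrow> ip g f = cnj (ip f g)"
    and ip_nonneg: "f \<in> H \<Longrightarrow> 0 \<le> Re (ip f f)"
    and ip_definite: "f \<in> H \<Longrightarrow> ip f f = 0 \<Longrightarrow> f = (\<lambda>x. 0)"
    and complete:
      "(\<And>m. s m \<in> H) \<Longrightarrow>
       (\<And>e. e > 0 \<Longrightarrow>
          \<exists>N. \<forall>m\<ge>N. \<forall>n\<ge>N. sqrt (Re (ip (\<lambda>x. s m x - s n x) (\<lambda>x. s m x - s n x))) < e) \<Longrightarrow>
       \<exists>f\<in>H. (\<lambda>m. sqrt (Re (ip (\<lambda>x. s m x - f x) (\<lambda>x. s m x - f x)))) \<longlonglongrightarrow> 0"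

locale reproducing_kernel_space = function_hilbert_space H ip
  for H :: "('x \<Rightarrow> complex) set" and ip +
  fixes K :: "'x \<Rightarrow> 'x \<Rightarrow> complex"
  assumes kernel_mem: "(\<lambda>x. K x y) \<in> H"
    and reproducing: "f \<in> H \<Longrightarrow> f y = ip f (\<lambda>x. K x y)"

text \<open>For a positive definite kernel the space and its inner product exist and are unique
  (Moore-Aronszajn).\<close>

definition rkhs :: "('x \<Rightarrow> 'x \<Rightarrow> complex) \<Rightarrow> ('x \<Rightarrow> complex) set" where
  "rkhs K = (THE H. \<exists>ip. reproducing_kernel_space H ip K)"

definition rkhs_inner ::
    "('x \<Rightarrow> 'x \<Rightarrow> complex) \<Rightarrow> ('x \<Rightarrow> complex) \<Rightarrow> ('x \<Rightarrow> complex) \<Rightarrow> complex" where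
  "rkhs_inner K f g =
     (THE z. \<exists>H ip. reproducing_kernel_space H ip K \<and> f \<in> H \<and> g \<in> H \<and> z = ip f g)"

definition rkhs_norm :: "('x \<Rightarrow> 'x \<Rightarrow> complex) \<Rightarrow> ('x \<Rightarrow> complex) \<Rightarrow> real" where
  "rkhs_norm K f = sqrt (Re (rkhs_inner K f f))"

definition C_kernel :: "(real^'n::finite) measure \<Rightarrow> 'n schwartz \<Rightarrow> 'n schwartz \<Rightarrow> complex" where
  "C_kernel \<sigma> \<phi> \<psi> = C_fun \<sigma> (\<phi> - \<psi>)"

end

theory Submission
  imports Defs
begin

text \<open>Write \<open>e_\<psi>\<close> for the function \<open>\<omega> \<mapsto> exp (\<i> \<langle>\<omega>, \<psi>\<rangle>)\<close> on the space of tempered distributions. The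
  transform of \<open>f\<close> at \<open>\<psi>\<close> is the inner product of \<open>f\<close> with \<open>e_\<psi>\<close>, and the kernel at \<open>(\<phi>, \<psi>)\<close> is the inner
  product of \<open>e_\<psi>\<close> with \<open>e_\<phi>\<close>. So the transform is the standard map from a Hilbert space to functions
  on the index set of a family of vectors. If the family is total, the map is injective; the inner product
  of L2 can then be carried over to its image, which becomes a complete space of functions in
  which the transforms of the \<open>e_\<psi>\<close> are reproducing kernels
  (\<open>reproducing_kernel_space_F_transform\<close>). A kernel has at most one such space
  (\<open>reproducing_kernel_space_unique\<close>), so the image is the reproducing kernel Hilbert space and the
  transform is isometric.

  The substance is the totality of the exponentials (\<open>exponentials_total_L1\<close>): a function whose transform
  vanishes is zero almost everywhere. By the uniqueness theorem for characteristic functions on the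
  real line, applied to one test function after the other, such a function integrates to zero
  over every set in the sigma-algebra generated by the pairings with single test functions. This is the whole
  Borel sigma-algebra of the weak-* topology (\<open>sets_borel_tempered_dist\<close>), although that topology has
  no countable base: the Schwartz space is separable, the dual is a countable union of equicontinuous
  sets, and on each of these the weak-* topology is generated by a countable dense set of test functions.\<close>

section \<open>Uniqueness of the reproducing kernel Hilbert space\<close>

context function_hilbert_space
begin

abbreviation sq :: "('x \<Rightarrow> complex) \<Rightarrow> real" where
  "sq f \<equiv> Re (ip f f)"

lemma ip_add_right:
  assumes "f \<in> H" "g \<in> H" "h \<in> H"
  shows "ip f (\<lambda>x. g x + h x) = ip f g + ip f h"
  using ip_cnj[OF add_mem[OF assms(2,3)] assms(1)] ip_add[OF assms(2,3,1)]
    ip_cnj[OF assms(2,1)] ip_cnj[OF assms(3,1)] by simp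

lemma ip_scale_right:
  assumes "f \<in> H" "g \<in> H"
  shows "ip f (\<lambda>x. c * g x) = cnj c * ip f g"
  using ip_cnj[OF scale_mem[OF assms(2)] assms(1)] ip_scale[OF assms(2,1)]
    ip_cnj[OF assms(2,1)] by simp

lemma sq_add_scale:
  assumes "f \<in> H" "g \<in> H"
  shows "sq (\<lambda>x. f x + c * g x) = sq f + 2 * Re (cnj c * ip f g) + (cmod c)\<^sup>2 * sq g"
proof -
  have cg: "(\<lambda>x. c * g x) \<in> H"
    using assms scale_mem by auto
  have "ip (\<lambda>x. f x + c * g x) (\<lambda>x. f x + c * g x) =
      ip f f + cnj c * ip f g + c * cnj (ip f g) + c * cnj c * ip g g"
    using assms cg ip_cnj[OF assms]
    by (simp add: ip_add ip_add_right ip_scale ip_scale_right add_mem algebra_simps)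
  then have "sq (\<lambda>x. f x + c * g x) =
      sq f + Re (cnj c * ip f g) + Re (c * cnj (ip f g)) + Re (c * cnj c * ip g g)"
    by simp
  moreover have "Re (c * cnj (ip f g)) = Re (cnj c * ip f g)"
    by simp
  moreover have "Re (c * cnj c * ip g g) = (cmod c)\<^sup>2 * sq g"
    by (simp flip: complex_norm_square)
  ultimately show ?thesis
    by linarith
qed

lemma sq_diff:
  assumes "f \<in> H" "g \<in> H"
  shows "sq (\<lambda>x. f x - g x) = sq f - 2 * Re (ip f g) + sq g"
  using sq_add_scale[OF assms, of "-1"] by simp

lemma diff_mem:
  assumes "f \<in> H" "g \<in> H"
  shows "(\<lambda>x. f x - g x) \<in> H"
  using add_mem[OF assms(1) scale_mem[OF assms(2), of "-1"]] by simp

lemma sq_diff_commute: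
  assumes "f \<in> H" "g \<in> H"
  shows "sq (\<lambda>x. f x - g x) = sq (\<lambda>x. g x - f x)"
  using sq_diff[OF assms] sq_diff[OF assms(2,1)] ip_cnj[OF assms] by simp

text \<open>The parallelogram law, applied to \<open>f - u\<close> and \<open>f - v\<close>. If \<open>u\<close>, \<open>v\<close> and their midpoint
  lie in a subspace and \<open>u\<close>, \<open>v\<close> nearly minimise the distance to \<open>f\<close>, then this forces \<open>u\<close> and \<open>v\<close>
  to be close together.\<close>

lemma sq_diff_midpoint:
  assumes "f \<in> H" "u \<in> H" "v \<in> H"
  shows "sq (\<lambda>x. u x - v x) = 2 * sq (\<lambda>x. f x - u x) + 2 * sq (\<lambda>x. f x - v x)
      - 4 * sq (\<lambda>x. f x - (1/2) * (u x + v x))"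
proof -
  have "(\<lambda>x. f x - (1/2) * (u x + v x)) = (\<lambda>x. f x + (-1/2) * (u x + v x))"
    by (simp add: fun_eq_iff)
  moreover have "sq (\<lambda>x. u x + v x) = sq u + 2 * Re (ip u v) + sq v"
    using sq_add_scale[OF assms(2,3), of 1] by simp
  ultimately have "4 * sq (\<lambda>x. f x - (1/2) * (u x + v x)) =
      4 * sq f - 4 * (Re (ip f u) + Re (ip f v)) + (sq u + 2 * Re (ip u v) + sq v)"
    using sq_add_scale[OF assms(1) add_mem[OF assms(2,3)], of "-1/2"]
    by (simp add: ip_add_right assms power2_eq_square field_simps)
  then show ?thesis
    by (simp add: sq_diff assms)
qed

end

text \<open>The linear span of the functions \<open>K(-, y)\<close>. It depends on the kernel alone, which is what lets
  two spaces with the same kernel be compared.\<close>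

inductive_set kernel_span :: "('x \<Rightarrow> 'x \<Rightarrow> complex) \<Rightarrow> ('x \<Rightarrow> complex) set"
  for K where
  zero: "(\<lambda>x. 0) \<in> kernel_span K"
| step: "v \<in> kernel_span K \<Longrightarrow> (\<lambda>x. v x + c * K x y) \<in> kernel_span K"

lemma kernel_span_scale:
  "v \<in> kernel_span K \<Longrightarrow> (\<lambda>x. a * v x) \<in> kernel_span K"
proof (induction rule: kernel_span.induct)
  case (step v c y)
  then show ?case
    using kernel_span.step[OF step.IH, of "a * c" y] by (simp add: algebra_simps)
qed (simp add: kernel_span.zero)

lemma kernel_span_add:
  "w \<in> kernel_span K \<Longrightarrow> v \<in> kernel_span K \<Longrightarrow> (\<lambda>x. v x + w x) \<in> kernel_span K"
proof (induction rule: kernel_span.induct)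
  case (step w c y)
  then show ?case
    using kernel_span.step[OF step.IH, of c y] by (simp add: algebra_simps)
qed simp

context reproducing_kernel_space
begin

lemma kernel_span_mem: "v \<in> kernel_span K \<Longrightarrow> v \<in> H"
proof (induction rule: kernel_span.induct)
  case (step v c y)
  then show ?case
    by (intro add_mem scale_mem kernel_mem)
qed (rule zero_mem)

text \<open>One quadratic inequality serves twice. Since \<open>u y\<close> is the inner product of \<open>u\<close> with \<open>K(-, y)\<close>,
  the squared norm of \<open>u - c K(-, y)\<close> is a quadratic in \<open>c\<close>, and a lower bound \<open>d\<close> for it bounds the
  linear coefficient. With \<open>d = 0\<close> this is the Cauchy-Schwarz bound for point evaluation; with \<open>d\<close> the
  squared distance of \<open>f\<close> from the span of the kernel and \<open>u = f - v\<close> it says that the residual of a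
  near-minimiser is nearly orthogonal to \<open>K(-, y)\<close>, that is, nearly zero at \<open>y\<close>.\<close>

lemma eval_bound:
  assumes u: "u \<in> H" and d: "\<And>c. d \<le> sq (\<lambda>x. u x - c * K x y)"
  shows "(cmod (u y))\<^sup>2 \<le> Re (K y y) * (sq u - d)"
proof -
  define a where "a = (cmod (u y))\<^sup>2"
  define k where "k = Re (K y y)"
  \<comment> \<open>Only the multiples \<open>c = t * u y\<close> with real \<open>t\<close> are needed: they make the linear term real.\<close>
  have quad: "d \<le> sq u - 2 * t * a + t\<^sup>2 * a * k" for t :: real
  proof -
    have "sq (\<lambda>x. u x + - (of_real t * u y) * K x y) =
        sq u + 2 * Re (cnj (- (of_real t * u y)) * u y)
          + (cmod (- (of_real t * u y)))\<^sup>2 * Re (K y y)"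
      unfolding reproducing[OF u, of y] reproducing[OF kernel_mem, of y y]
      by (rule sq_add_scale[OF u kernel_mem])
    moreover have "Re (cnj (- (of_real t * u y)) * u y) = - (t * a)"
      unfolding a_def cmod_power2 by (simp add: algebra_simps power2_eq_square)
    moreover have "(cmod (- (of_real t * u y)))\<^sup>2 = t\<^sup>2 * a"
      by (simp add: a_def norm_mult power_mult_distrib)
    ultimately show ?thesis
      using d[of "of_real t * u y"] by (simp add: k_def)
  qed
  have "k \<ge> 0"
    unfolding k_def using reproducing[OF kernel_mem, of y y] ip_nonneg[OF kernel_mem, of y]
    by simp
  have "a \<ge> 0"
    by (simp add: a_def)
  have "a \<le> k * (sq u - d)"
  proof (cases "k = 0")
    case True
    have "a = 0"
    proof (rule ccontr)
      assume "a \<noteq> 0"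
      define t where "t = (sq u - d + 1) / (2 * a)"
      have "2 * t * a = sq u - d + 1"
        using \<open>a \<noteq> 0\<close> by (simp add: t_def)
      then show False
        using quad[of t] True by simp
    qed
    then show ?thesis
      using True by simp
  next
    case False
    then have "d \<le> sq u - a / k"
      using quad[of "1 / k"] by (simp add: power2_eq_square)
    then show ?thesis
      using False \<open>k \<ge> 0\<close> by (simp add: field_simps)
  qed
  then show ?thesis
    by (simp add: a_def k_def)
qed

lemma tendsto_eval:
  assumes mem: "\<And>m. s m \<in> H" and p: "p \<in> H"
    and lim: "(\<lambda>m. sq (\<lambda>x. s m x - p x)) \<longlonglongrightarrow> 0"
  shows "(\<lambda>m. s m y) \<longlonglongrightarrow> p y"
proof -
  have "norm ((cmod (s m y - p y))\<^sup>2) \<le> Re (K y y) * sq (\<lambda>x. s m x - p x)" for m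
    using eval_bound[of "\<lambda>x. s m x - p x" 0 y] diff_mem[OF mem p]
      ip_nonneg[OF diff_mem[OF diff_mem[OF mem p] scale_mem[OF kernel_mem]]] by simp
  moreover have "(\<lambda>m. Re (K y y) * sq (\<lambda>x. s m x - p x)) \<longlonglongrightarrow> 0"
    using tendsto_mult_left[OF lim, of "Re (K y y)"] by simp
  ultimately have "(\<lambda>m. (cmod (s m y - p y))\<^sup>2) \<longlonglongrightarrow> 0"
    by (rule Lim_null_comparison[OF always_eventually[OF allI]])
  then have "(\<lambda>m. sqrt ((cmod (s m y - p y))\<^sup>2)) \<longlonglongrightarrow> sqrt 0"
    by (rule tendsto_real_sqrt)
  then show ?thesis
    using LIM_zero_cancel[OF tendsto_norm_zero_cancel] by simp
qed

text \<open>A minimising sequence \<open>v\<close> for the distance from \<open>f\<close> to the span is Cauchy by the parallelogram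
  law, so it has a limit \<open>p\<close>. Its values converge to those of \<open>p\<close>, and, as the residuals
  become orthogonal to every \<open>K(-, y)\<close>, also to those of \<open>f\<close>. Hence \<open>p = f\<close>.\<close>

lemma kernel_span_dense:
  assumes f: "f \<in> H"
  obtains v where "\<And>m. v m \<in> kernel_span K" "(\<lambda>m. sq (\<lambda>x. v m x - f x)) \<longlonglongrightarrow> 0"
proof -
  define D where "D = (INF w \<in> kernel_span K. sq (\<lambda>x. f x - w x))"
  have bdd: "bdd_below ((\<lambda>w. sq (\<lambda>x. f x - w x)) ` kernel_span K)"
    using ip_nonneg[OF diff_mem[OF f kernel_span_mem]] by (intro bdd_belowI2[where m = 0])
  have D_le: "D \<le> sq (\<lambda>x. f x - w x)" if "w \<in> kernel_span K" for w
    unfolding D_def using cINF_lower[OF bdd that] .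
  have "\<exists>w\<in>kernel_span K. sq (\<lambda>x. f x - w x) < D + 1 / (real m + 1)" for m
  proof -
    have "D < D + 1 / (real m + 1)"
      by simp
    then show ?thesis
      unfolding D_def using cINF_less_iff[OF _ bdd] kernel_span.zero by blast
  qed
  then obtain v where v: "\<And>m. v m \<in> kernel_span K"
      and v_D: "\<And>m. sq (\<lambda>x. f x - v m x) < D + 1 / (real m + 1)"
    by metis
  note vH = kernel_span_mem[OF v]
  have sq_vv: "sq (\<lambda>x. v m x - v n x) \<le> 2 / (real m + 1) + 2 / (real n + 1)" for m n
    using sq_diff_midpoint[OF f vH vH, of m n] v_D[of m] v_D[of n]
      D_le[OF kernel_span_scale[OF kernel_span_add[OF v[of n] v[of m]], of "1/2"]]
    by (simp add: algebra_simps)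
  have "\<exists>p\<in>H. (\<lambda>m. sqrt (sq (\<lambda>x. v m x - p x))) \<longlonglongrightarrow> 0"
  proof (rule complete[OF vH])
    fix e :: real assume "e > 0"
    then obtain N where N: "1 / (real N + 1) < e\<^sup>2 / 4"
      using reals_Archimedean[of "e\<^sup>2 / 4"] by (auto simp: inverse_eq_divide add.commute)
    have "sqrt (sq (\<lambda>x. v m x - v n x)) < e" if "m \<ge> N" "n \<ge> N" for m n
    proof -
      have "2 / (real m + 1) \<le> 2 / (real N + 1)" "2 / (real n + 1) \<le> 2 / (real N + 1)"
        using that by (auto intro!: divide_left_mono mult_pos_pos)
      then have "sq (\<lambda>x. v m x - v n x) < e\<^sup>2"
        using sq_vv[of m n] N by simp
      then show ?thesis
        using \<open>e > 0\<close> by (simp add: real_less_lsqrt real_sqrt_less_iff)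
    qed
    then show "\<exists>N. \<forall>m\<ge>N. \<forall>n\<ge>N. sqrt (sq (\<lambda>x. v m x - v n x)) < e"
      by blast
  qed
  then obtain p where p: "p \<in> H" and "(\<lambda>m. sqrt (sq (\<lambda>x. v m x - p x))) \<longlonglongrightarrow> 0"
    by blast
  then have v_p: "(\<lambda>m. sq (\<lambda>x. v m x - p x)) \<longlonglongrightarrow> 0"
    using tendsto_power[of "\<lambda>m. sqrt (sq (\<lambda>x. v m x - p x))" 0 sequentially 2]
    by (simp add: ip_nonneg diff_mem vH)
  have "(\<lambda>m. v m y) \<longlonglongrightarrow> f y" for y
  proof -
    have "norm ((cmod (f y - v m y))\<^sup>2) \<le> Re (K y y) * (1 / (real m + 1))" for m
    proof -
      have "D \<le> sq (\<lambda>x. (f x - v m x) - c * K x y)" for c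
        using D_le[OF kernel_span.step[OF v[of m], of c y]] by (simp add: algebra_simps)
      then have "(cmod (f y - v m y))\<^sup>2 \<le> Re (K y y) * (sq (\<lambda>x. f x - v m x) - D)"
        by (rule eval_bound[OF diff_mem[OF f vH]])
      also have "\<dots> \<le> Re (K y y) * (1 / (real m + 1))"
        using v_D[of m] ip_nonneg[OF kernel_mem, of y] reproducing[OF kernel_mem, of y y]
        by (intro mult_left_mono) auto
      finally show ?thesis
        by simp
    qed
    moreover have "(\<lambda>m. Re (K y y) * (1 / (real m + 1))) \<longlonglongrightarrow> 0"
      using tendsto_mult_left[OF LIMSEQ_inverse_real_of_nat, of "Re (K y y)"]
      by (simp add: inverse_eq_divide add.commute)
    ultimately have "(\<lambda>m. (cmod (f y - v m y))\<^sup>2) \<longlonglongrightarrow> 0"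
      by (rule Lim_null_comparison[OF always_eventually[OF allI]])
    then have "(\<lambda>m. sqrt ((cmod (f y - v m y))\<^sup>2)) \<longlonglongrightarrow> sqrt 0"
      by (rule tendsto_real_sqrt)
    then show ?thesis
      using LIM_zero_cancel[OF tendsto_norm_zero_cancel]
      by (simp add: norm_minus_commute[of "f y"])
  qed
  then have "f = p"
    using tendsto_eval[OF vH p v_p] LIMSEQ_unique by blast
  then show ?thesis
    using that[of v] v v_p by simp
qed

end

lemma ip_kernel_span_eq:
  assumes "reproducing_kernel_space H ip K" "reproducing_kernel_space H' ip' K"
    and u: "u \<in> H" "u \<in> H'" and "v \<in> kernel_span K"
  shows "ip u v = ip' u v"
  using assms(5)
proof (induction rule: kernel_span.induct)
  interpret A: reproducing_kernel_space H ip K by fact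
  interpret B: reproducing_kernel_space H' ip' K by fact
  case zero
  show ?case
    using A.ip_scale_right[OF u(1) A.zero_mem, of 0] B.ip_scale_right[OF u(2) B.zero_mem, of 0]
    by simp
next
  interpret A: reproducing_kernel_space H ip K by fact
  interpret B: reproducing_kernel_space H' ip' K by fact
  case (step v c y)
  have "ip u (\<lambda>x. K x y) = ip' u (\<lambda>x. K x y)"
    using A.reproducing[OF u(1)] B.reproducing[OF u(2)] by simp
  with step u show ?case
    by (simp add: A.ip_add_right B.ip_add_right A.ip_scale_right B.ip_scale_right
        A.kernel_span_mem B.kernel_span_mem A.scale_mem B.scale_mem A.kernel_mem B.kernel_mem)
qed

text \<open>Approximate \<open>f\<close> by a sequence \<open>v\<close> in the span of the kernel. The two inner products agree on the
  span, so \<open>v\<close> is Cauchy in \<open>H'\<close> too. Its limit there has the same values as \<open>f\<close>, because norm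
  convergence implies pointwise convergence in both spaces.\<close>

lemma reproducing_kernel_space_unique:
  assumes "reproducing_kernel_space H ip K" "reproducing_kernel_space H' ip' K" and f: "f \<in> H"
  shows "f \<in> H'" and "ip f f = ip' f f"
proof -
  interpret A: reproducing_kernel_space H ip K by fact
  interpret B: reproducing_kernel_space H' ip' K by fact
  obtain v where v: "\<And>m. v m \<in> kernel_span K"
      and v_f: "(\<lambda>m. A.sq (\<lambda>x. v m x - f x)) \<longlonglongrightarrow> 0"
    using A.kernel_span_dense[OF f] by blast
  note vA = A.kernel_span_mem[OF v] and vB = B.kernel_span_mem[OF v]
  have sq_eq: "A.sq (\<lambda>x. v m x - v n x) = B.sq (\<lambda>x. v m x - v n x)" for m n
    using ip_kernel_span_eq[OF assms(1,2) vA vB v]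
    by (simp add: A.sq_diff[OF vA vA] B.sq_diff[OF vB vB])
  have "\<exists>p\<in>H'. (\<lambda>m. sqrt (B.sq (\<lambda>x. v m x - p x))) \<longlonglongrightarrow> 0"
  proof (rule B.complete[OF vB])
    fix e :: real assume "e > 0"
    then obtain N where N: "\<And>m. m \<ge> N \<Longrightarrow> A.sq (\<lambda>x. v m x - f x) < e\<^sup>2 / 4"
      using order_tendstoD(2)[OF v_f, of "e\<^sup>2 / 4"] by (auto simp: eventually_sequentially)
    have "sqrt (B.sq (\<lambda>x. v m x - v n x)) < e" if "m \<ge> N" "n \<ge> N" for m n
    proof -
      have "A.sq (\<lambda>x. v m x - v n x) \<le>
          2 * A.sq (\<lambda>x. v m x - f x) + 2 * A.sq (\<lambda>x. v n x - f x)"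
        using A.sq_diff_midpoint[OF f vA vA, of m n] A.sq_diff_commute[OF f vA]
          A.ip_nonneg[OF A.diff_mem[OF f A.scale_mem[OF A.add_mem[OF vA vA]]], of "1/2" m n]
        by simp
      then have "B.sq (\<lambda>x. v m x - v n x) < e\<^sup>2"
        using N[OF that(1)] N[OF that(2)] sq_eq[of m n] by simp
      then show ?thesis
        using \<open>e > 0\<close> by (simp add: real_less_lsqrt)
    qed
    then show "\<exists>N. \<forall>m\<ge>N. \<forall>n\<ge>N. sqrt (B.sq (\<lambda>x. v m x - v n x)) < e"
      by blast
  qed
  then obtain p where p: "p \<in> H'" and "(\<lambda>m. sqrt (B.sq (\<lambda>x. v m x - p x))) \<longlonglongrightarrow> 0"
    by blast
  then have v_p: "(\<lambda>m. B.sq (\<lambda>x. v m x - p x)) \<longlonglongrightarrow> 0"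
    using tendsto_power[of "\<lambda>m. sqrt (B.sq (\<lambda>x. v m x - p x))" 0 sequentially 2]
    by (simp add: B.ip_nonneg B.diff_mem vB)
  have "f = p"
    using A.tendsto_eval[OF vA f v_f] B.tendsto_eval[OF vB p v_p] LIMSEQ_unique by blast
  with p show fB: "f \<in> H'"
    by simp
  \<comment> \<open>The mixed terms \<open>ip f (v m)\<close> agree, so the two squared distances differ by a constant; both tend to 0.\<close>
  have "A.sq (\<lambda>x. f x - v m x) - B.sq (\<lambda>x. f x - v m x) = A.sq f - B.sq f" for m
    using ip_kernel_span_eq[OF assms(1,2) f fB v] ip_kernel_span_eq[OF assms(1,2) vA vB v]
    by (simp add: A.sq_diff[OF f vA] B.sq_diff[OF fB vB])
  moreover have "(\<lambda>m. A.sq (\<lambda>x. f x - v m x) - B.sq (\<lambda>x. f x - v m x)) \<longlonglongrightarrow> 0"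
    unfolding A.sq_diff_commute[OF f vA] B.sq_diff_commute[OF fB vB]
    using tendsto_diff[OF v_f v_p[folded \<open>f = p\<close>]] by simp
  ultimately have "A.sq f = B.sq f"
    by (simp add: LIMSEQ_const_iff)
  then show "ip f f = ip' f f"
    using A.ip_cnj[OF f f] B.ip_cnj[OF fB fB] by (simp add: complex_eq_iff)
qed

lemma rkhs_eq:
  assumes "reproducing_kernel_space H ip K"
  shows "rkhs K = H"
  unfolding rkhs_def
proof (rule the_equality)
  show "H' = H" if "\<exists>ip'. reproducing_kernel_space H' ip' K" for H'
    using that assms by (auto dest: reproducing_kernel_space_unique(1))
qed (use assms in blast)

lemma rkhs_norm_eq:
  assumes "reproducing_kernel_space H ip K" "f \<in> H"
  shows "rkhs_norm K f = sqrt (Re (ip f f))"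
proof -
  have "rkhs_inner K f f = ip f f"
    unfolding rkhs_inner_def
  proof (rule the_equality)
    show "z = ip f f"
      if "\<exists>H' ip'. reproducing_kernel_space H' ip' K \<and> f \<in> H' \<and> f \<in> H' \<and> z = ip' f f" for z
    proof -
      from that obtain H' ip' where *: "reproducing_kernel_space H' ip' K" "f \<in> H'" "z = ip' f f"
        by blast
      show ?thesis
        using reproducing_kernel_space_unique(2)[OF *(1) assms(1) *(2)] *(3) by simp
    qed
  qed (use assms in blast)
  then show ?thesis
    by (simp add: rkhs_norm_def)
qed

section \<open>Borel sets of tempered distributions\<close>

definition vanishing_continuous :: "('a::euclidean_space \<Rightarrow> real) \<Rightarrow> bool" where
  "vanishing_continuous f \<longleftrightarrow> continuous_on UNIV f \<and> (f \<longlongrightarrow> 0) at_infinity"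

text \<open>This yields separability, in the supremum norm, of every set of continuous functions
  vanishing at infinity, by sorting the functions into countably many classes of small diameter. The
  class of \<open>f\<close> records a radius outside which \<open>f\<close> is small, a modulus of continuity inside, and the
  values of \<open>f\<close>, rounded, on a finite net that depends on radius and modulus only. Choosing one
  element from each class never leaves the given set of functions, so separability is obtained
  for subsets directly.\<close>

lemma vanishing_continuous_countable_partition:
  fixes e :: real
  assumes "e > 0"
  obtains L :: "('a::euclidean_space \<Rightarrow> real) \<Rightarrow> nat" where
    "\<And>f g x. vanishing_continuous f \<Longrightarrow> vanishing_continuous g \<Longrightarrow> L f = L g \<Longrightarrow>
      \<bar>f x - g x\<bar> < e"
proof -
  define e' where "e' = e / 4"
  have "e' > 0"
    using assms by (simp add: e'_def)
  have "\<exists>cs. cball 0 (real R) \<subseteq> (\<Union>c\<in>set cs. ball c (1 / real (Suc j))) \<and>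
      set cs \<subseteq> cball (0::'a) (real R)" for R j
  proof -
    have "\<exists>C. finite C \<and> C \<subseteq> cball (0::'a) (real R) \<and>
        cball 0 (real R) \<subseteq> (\<Union>c\<in>C. ball c (1 / real (Suc j)))"
      using compact_imp_seq_compact[OF compact_cball]
      by (intro seq_compact_imp_totally_bounded[rule_format]) auto
    then show ?thesis
      using finite_list by metis
  qed
  then obtain cs where
      cs: "\<And>R j. cball 0 (real R) \<subseteq> (\<Union>c\<in>set (cs R j). ball c (1 / real (Suc j)))"
      and cs_sub: "\<And>R j. set (cs R j) \<subseteq> cball (0::'a) (real R)"
    by metis
  \<comment> \<open>\<open>R\<close> is a radius and \<open>1 / Suc j\<close> a modulus of continuity that suit \<open>f\<close>.\<close>
  define good :: "('a \<Rightarrow> real) \<Rightarrow> nat \<Rightarrow> nat \<Rightarrow> bool" where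
    "good f R j \<longleftrightarrow> (\<forall>x. norm x > real R \<longrightarrow> \<bar>f x\<bar> < e') \<and>
      (\<forall>x\<in>cball 0 (real R). \<forall>y\<in>cball 0 (real R). dist x y < 1 / real (Suc j) \<longrightarrow> \<bar>f x - f y\<bar> < e')"
    for f R j
  have "\<exists>R j. good f R j" if f: "vanishing_continuous f" for f
  proof -
    have "eventually (\<lambda>x. \<bar>f x\<bar> < e') at_infinity"
      using f \<open>e' > 0\<close> tendstoD[of f 0 at_infinity e']
      by (auto simp: vanishing_continuous_def dist_real_def)
    then obtain b where b: "\<And>x. norm x \<ge> b \<Longrightarrow> \<bar>f x\<bar> < e'"
      by (auto simp: eventually_at_infinity)
    obtain R :: nat where R: "real R \<ge> b"
      using real_arch_simple by blast
    have "uniformly_continuous_on (cball 0 (real R)) f"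
      using f by (intro compact_uniformly_continuous)
        (auto simp: vanishing_continuous_def intro: continuous_on_subset)
    then obtain \<delta> where "\<delta> > 0" and \<delta>: "\<And>x y. x \<in> cball 0 (real R) \<Longrightarrow> y \<in> cball 0 (real R) \<Longrightarrow>
        dist x y < \<delta> \<Longrightarrow> dist (f x) (f y) < e'"
      using \<open>e' > 0\<close> by (metis uniformly_continuous_on_def dist_commute)
    obtain j where j: "1 / real (Suc j) < \<delta>"
      using reals_Archimedean[OF \<open>\<delta> > 0\<close>] by (auto simp: inverse_eq_divide)
    have "good f R j"
      unfolding good_def using b R \<delta> j by (force simp: dist_real_def)
    then show ?thesis
      by blast
  qed
  then obtain R j where good: "\<And>f. vanishing_continuous f \<Longrightarrow> good f (R f) (j f)"
    by metis
  define L where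
    "L f = to_nat (R f, j f, map (\<lambda>c. \<lfloor>f c / e'\<rfloor>) (cs (R f) (j f)))" for f
  have "\<bar>f x - g x\<bar> < e"
    if fg: "vanishing_continuous f" "vanishing_continuous g" and "L f = L g" for f g x
  proof -
    have Rj: "R f = R g" "j f = j g"
      and floors: "\<And>c. c \<in> set (cs (R f) (j f)) \<Longrightarrow> \<lfloor>f c / e'\<rfloor> = \<lfloor>g c / e'\<rfloor>"
      using \<open>L f = L g\<close> by (auto simp: L_def)
    have gf: "good f (R f) (j f)" and gg: "good g (R f) (j f)"
      using good fg Rj by metis+
    show ?thesis
    proof (cases "norm x > real (R f)")
      case True
      then have "\<bar>f x\<bar> < e'" "\<bar>g x\<bar> < e'"
        using gf gg by (auto simp: good_def)
      then show ?thesis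
        using \<open>e' > 0\<close> by (simp add: e'_def)
    next
      case False
      then have x: "x \<in> cball 0 (real (R f))"
        by simp
      then obtain c where c: "c \<in> set (cs (R f) (j f))" "dist x c < 1 / real (Suc (j f))"
        using cs[of "R f" "j f"] by (auto simp: dist_commute)
      then have "c \<in> cball 0 (real (R f))"
        using cs_sub by blast
      then have "\<bar>f x - f c\<bar> < e'" "\<bar>g x - g c\<bar> < e'"
        using gf gg x c(2) unfolding good_def by blast+
      moreover have "\<bar>f c - g c\<bar> < e'"
      proof -
        have "\<bar>f c / e' - g c / e'\<bar> < 1"
          using floors[OF c(1)] by linarith
        then have "\<bar>f c - g c\<bar> / e' < 1"
          using \<open>e' > 0\<close> by (simp flip: diff_divide_distrib)
        then show ?thesis
          using \<open>e' > 0\<close> by (simp add: divide_less_eq)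
      qed
      ultimately show ?thesis
        unfolding e'_def by linarith
    qed
  qed
  then show ?thesis
    using that by blast
qed

lemma schwartz_fun_apply: "schwartz_fun (schwartz_apply f)"
  by transfer simp

lemma weighted_deriv_add:
  "weighted_deriv k is (schwartz_apply (f + g)) x =
    weighted_deriv k is (schwartz_apply f) x + weighted_deriv k is (schwartz_apply g) x"
proof -
  have "schwartz_apply (f + g) = (\<lambda>x. schwartz_apply f x + schwartz_apply g x)"
    by transfer simp
  moreover have "smooth (schwartz_apply f)" "smooth (schwartz_apply g)"
    using schwartz_fun_apply by (auto simp: schwartz_fun_def)
  ultimately show ?thesis
    by (simp add: weighted_deriv_def iter_deriv_add distrib_left)
qed

lemma weighted_deriv_scale:
  "weighted_deriv k is (schwartz_apply (c *\<^sub>R f)) x = c * weighted_deriv k is (schwartz_apply f) x"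
proof -
  have "schwartz_apply (c *\<^sub>R f) = (\<lambda>x. c * schwartz_apply f x)"
    by transfer simp
  moreover have "smooth (schwartz_apply f)"
    using schwartz_fun_apply by (auto simp: schwartz_fun_def)
  ultimately show ?thesis
    by (simp add: weighted_deriv_def iter_deriv_scale)
qed

lemma weighted_deriv_diff:
  "weighted_deriv k is (schwartz_apply (f - g)) x =
    weighted_deriv k is (schwartz_apply f) x - weighted_deriv k is (schwartz_apply g) x"
  using weighted_deriv_add[of k "is" "f - g" g x] by simp

lemma weighted_deriv_le_seminorm:
  "\<bar>weighted_deriv k is (schwartz_apply f) x\<bar> \<le> schwartz_seminorm k is f"
proof -
  have "bounded (range (weighted_deriv k is (schwartz_apply f)))"
    using schwartz_fun_apply[of f] by (auto simp: schwartz_fun_def)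
  then have "bdd_above (range (\<lambda>x. \<bar>weighted_deriv k is (schwartz_apply f) x\<bar>))"
    by (auto simp: bounded_iff bdd_above_def)
  then show ?thesis
    unfolding schwartz_seminorm_def by (intro cSUP_upper) auto
qed

lemma schwartz_seminorm_leI:
  "(\<And>x. \<bar>weighted_deriv k is (schwartz_apply f) x\<bar> \<le> B) \<Longrightarrow> schwartz_seminorm k is f \<le> B"
  unfolding schwartz_seminorm_def by (intro cSUP_least) auto

lemma schwartz_seminorm_nonneg: "0 \<le> schwartz_seminorm k is f"
  using weighted_deriv_le_seminorm[of k "is" f 0] by linarith

lemma schwartz_seminorm_add:
  "schwartz_seminorm k is (f + g) \<le> schwartz_seminorm k is f + schwartz_seminorm k is g"
proof (rule schwartz_seminorm_leI)
  show "\<bar>weighted_deriv k is (schwartz_apply (f + g)) x\<bar> \<le>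
      schwartz_seminorm k is f + schwartz_seminorm k is g" for x
    using weighted_deriv_le_seminorm[of k "is" f x] weighted_deriv_le_seminorm[of k "is" g x]
    by (simp add: weighted_deriv_add)
qed

lemma schwartz_seminorm_scale_le:
  "schwartz_seminorm k is (c *\<^sub>R f) \<le> \<bar>c\<bar> * schwartz_seminorm k is f"
  by (rule schwartz_seminorm_leI)
    (simp add: weighted_deriv_scale abs_mult mult_left_mono weighted_deriv_le_seminorm)

text \<open>Raising the weight by one power bounds \<open>(1 + |x|\<^sup>2)\<close> times the function, whence the decay.\<close>

lemma vanishing_continuous_weighted_deriv:
  "vanishing_continuous (weighted_deriv k is (schwartz_apply (f :: 'n::finite schwartz)))"
  unfolding vanishing_continuous_def
proof
  let ?w = "weighted_deriv k is (schwartz_apply f)"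
  have "continuous_on UNIV (iter_deriv is (schwartz_apply f))"
    using schwartz_fun_apply[of f]
    by (auto simp: schwartz_fun_def smooth_def
        intro!: differentiable_imp_continuous_within continuous_at_imp_continuous_on)
  then show "continuous_on UNIV ?w"
    unfolding weighted_deriv_def by (intro continuous_intros)
  define C where "C = schwartz_seminorm (Suc k) is f"
  have "norm (?w x) \<le> C * inverse (norm x)" if "norm x \<ge> 1" for x
  proof -
    have "norm x * \<bar>?w x\<bar> \<le> (1 + (norm x)\<^sup>2) * \<bar>?w x\<bar>"
      using that self_le_power[of "norm x" 2] by (intro mult_right_mono) auto
    also have "\<dots> = \<bar>weighted_deriv (Suc k) is (schwartz_apply f) x\<bar>"
      by (simp add: weighted_deriv_def abs_mult)
    also have "\<dots> \<le> C"
      unfolding C_def by (rule weighted_deriv_le_seminorm)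
    finally have "\<bar>?w x\<bar> * norm x \<le> C"
      by (simp add: mult.commute)
    then show ?thesis
      using that pos_le_divide_eq[of "norm x" "\<bar>?w x\<bar>" C]
      by (simp only: divide_inverse real_norm_def)
  qed
  then have "eventually (\<lambda>x. norm (?w x) \<le> C * inverse (norm x)) at_infinity"
    by (auto simp: eventually_at_infinity)
  moreover have "((\<lambda>x::real^'n. C * inverse (norm x)) \<longlongrightarrow> 0) at_infinity"
    by (intro tendsto_mult_right_zero tendsto_inverse_0_at_top filterlim_norm_at_top)
  ultimately show "(?w \<longlongrightarrow> 0) at_infinity"
    by (rule Lim_null_comparison)
qed

text \<open>An increasing sequence of seminorms that defines the Schwartz topology, obtained by enumerating all
  pairs of a weight and a list of coordinates.\<close>

definition schwartz_norm :: "nat \<Rightarrow> 'n::finite schwartz \<Rightarrow> real" where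
  "schwartz_norm N \<psi> = (\<Sum>i<N. case from_nat i of (k, is) \<Rightarrow> schwartz_seminorm k is \<psi>)"

lemma schwartz_norm_nonneg: "0 \<le> schwartz_norm N \<psi>"
  unfolding schwartz_norm_def
  by (intro sum_nonneg) (auto simp: schwartz_seminorm_nonneg split: prod.split)

lemma schwartz_norm_mono: "M \<le> N \<Longrightarrow> schwartz_norm M \<psi> \<le> schwartz_norm N \<psi>"
  unfolding schwartz_norm_def
  by (intro sum_mono2) (auto simp: schwartz_seminorm_nonneg split: prod.split)

lemma schwartz_norm_add: "schwartz_norm N (f + g) \<le> schwartz_norm N f + schwartz_norm N g"
  unfolding schwartz_norm_def sum.distrib[symmetric]
  by (intro sum_mono) (auto simp: schwartz_seminorm_add split: prod.split)

lemma schwartz_norm_scale_le: "schwartz_norm N (c *\<^sub>R f) \<le> \<bar>c\<bar> * schwartz_norm N f"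
  unfolding schwartz_norm_def sum_distrib_left
  by (intro sum_mono) (auto simp: schwartz_seminorm_scale_le split: prod.split)

lemma schwartz_norm_minus: "schwartz_norm N (f - g) = schwartz_norm N (g - f)"
  using schwartz_norm_scale_le[of N "-1" "f - g"] schwartz_norm_scale_le[of N "-1" "g - f"]
  by simp

lemma schwartz_seminorm_le_norm:
  "schwartz_seminorm k is \<psi> \<le> schwartz_norm (Suc (to_nat (k, is))) \<psi>"
  unfolding schwartz_norm_def
  by (simp add: sum_nonneg schwartz_seminorm_nonneg split: prod.split)

text \<open>For each precision \<open>m\<close> and each \<open>N\<close>
  the first \<open>N\<close> weighted derivatives of a function fall into one of countably many tuples of
  classes, and \<open>D\<close> picks one Schwartz function for each tuple that occurs.\<close>

lemma schwartz_separable: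
  obtains D :: "'n::finite schwartz set" where "countable D"
    "\<And>N \<psi> e. e > 0 \<Longrightarrow> \<exists>d\<in>D. schwartz_norm N (\<psi> - d) < e"
proof -
  have "\<exists>L :: (real^'n \<Rightarrow> real) \<Rightarrow> nat. \<forall>f g x. vanishing_continuous f \<longrightarrow>
      vanishing_continuous g \<longrightarrow> L f = L g \<longrightarrow> \<bar>f x - g x\<bar> < 1 / real (Suc m)" for m
    by (rule vanishing_continuous_countable_partition[of "1 / real (Suc m)"]) auto
  then obtain L :: "nat \<Rightarrow> (real^'n \<Rightarrow> real) \<Rightarrow> nat" where
    L: "\<And>m f g x. vanishing_continuous f \<Longrightarrow> vanishing_continuous g \<Longrightarrow> L m f = L m g \<Longrightarrow>
      \<bar>f x - g x\<bar> < 1 / real (Suc m)"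
    by metis
  define label where "label m N \<psi> =
      map (\<lambda>i. L m (case from_nat i of (k, is) \<Rightarrow> weighted_deriv k is (schwartz_apply \<psi>))) [0..<N]"
    for m N and \<psi> :: "'n schwartz"
  define D where "D = range (\<lambda>(m, N, l). SOME \<psi>. label m N \<psi> = l)"
  have "\<exists>d\<in>D. schwartz_norm N (\<psi> - d) < e" if "e > 0" for N \<psi> e
  proof -
    obtain m where m: "1 / real (Suc m) < e / (real N + 1)"
      using reals_Archimedean[of "e / (real N + 1)"] \<open>e > 0\<close> by (auto simp: inverse_eq_divide)
    define d where "d = (SOME \<phi>. label m N \<phi> = label m N \<psi>)"
    have "d \<in> D"
      unfolding D_def d_def by (rule image_eqI[of _ _ "(m, N, label m N \<psi>)"]) auto
    have "label m N d = label m N \<psi>"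
      unfolding d_def by (rule someI) (rule refl)
    then have same: "L m (case from_nat i of (k, is) \<Rightarrow> weighted_deriv k is (schwartz_apply d)) =
        L m (case from_nat i of (k, is) \<Rightarrow> weighted_deriv k is (schwartz_apply \<psi>))" if "i < N" for i
      using that by (simp add: label_def)
    have "(case from_nat i of (k, is) \<Rightarrow> schwartz_seminorm k is (\<psi> - d)) \<le> 1 / real (Suc m)"
      if "i < N" for i
    proof -
      obtain k :: nat and "is" :: "'n list" where ki: "from_nat i = (k, is)"
        by fastforce
      have "schwartz_seminorm k is (\<psi> - d) \<le> 1 / real (Suc m)"
        using L[OF vanishing_continuous_weighted_deriv vanishing_continuous_weighted_deriv,
            of m k "is" \<psi> k "is" d] same[OF that] ki
        by (intro schwartz_seminorm_leI) (simp add: weighted_deriv_diff less_imp_le)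
      then show ?thesis
        by (simp add: ki)
    qed
    then have "schwartz_norm N (\<psi> - d) \<le> (\<Sum>i<N. 1 / real (Suc m))"
      unfolding schwartz_norm_def by (intro sum_mono) auto
    also have "\<dots> \<le> (real N + 1) * (1 / real (Suc m))"
      by (simp add: divide_right_mono)
    also have "\<dots> < e"
      using m by (simp add: field_simps)
    finally show ?thesis
      using \<open>d \<in> D\<close> by blast
  qed
  moreover have "countable D"
    unfolding D_def by simp
  ultimately show ?thesis
    using that by blast
qed

lemma schwartz_nhd_zero:
  assumes "open U" "0 \<in> U"
  obtains N e where "e > 0" "\<And>\<psi> :: 'n::finite schwartz. schwartz_norm N \<psi> < e \<Longrightarrow> \<psi> \<in> U"
proof -
  have "\<exists>N e. e > 0 \<and> (\<forall>\<psi>. schwartz_norm N \<psi> < e \<longrightarrow> \<psi> \<in> U)"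
    using assms unfolding open_schwartz_def
  proof (induction rule: generate_topology.induct)
    case UNIV
    show ?case
      using zero_less_one by blast
  next
    case (Int U V)
    then obtain M d N e where de: "d > 0" "e > 0"
      and U: "\<And>\<psi>. schwartz_norm M \<psi> < d \<Longrightarrow> \<psi> \<in> U"
      and V: "\<And>\<psi>. schwartz_norm N \<psi> < e \<Longrightarrow> \<psi> \<in> V"
      by blast
    have "\<psi> \<in> U \<inter> V" if "schwartz_norm (max M N) \<psi> < min d e" for \<psi>
      using that schwartz_norm_mono[of M "max M N" \<psi>] schwartz_norm_mono[of N "max M N" \<psi>]
      by (intro IntI U V) auto
    then show ?case
      using de by (intro exI[of _ "max M N"] exI[of _ "min d e"]) auto
  next
    case (UN K)
    then show ?case
      by blast
  next
    case (Basis U)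
    then obtain k "is" f e where U: "U = {g. schwartz_seminorm k is (g - f) < e}"
      by auto
    have "schwartz_seminorm k is (\<psi> - f) < e"
      if "schwartz_norm (Suc (to_nat (k, is))) \<psi> < e - schwartz_seminorm k is (0 - f)" for \<psi>
      using that schwartz_seminorm_add[of k "is" \<psi> "0 - f"] schwartz_seminorm_le_norm[of k "is" \<psi>]
      by simp
    moreover have "e - schwartz_seminorm k is (0 - f) > 0"
      using Basis(2) U by simp
    ultimately show ?case
      unfolding U by blast
  qed
  then show ?thesis
    using that by blast
qed

lemma pairing_linear: "linear (pairing \<omega>)" and pairing_continuous: "continuous_on UNIV (pairing \<omega>)"
  using pairing[of \<omega>] by auto

text \<open>Letting one number \<open>N\<close> serve as the order and as the constant makes the whole dual a union of
  countably many equicontinuous sets, the balls \<open>order_ball N\<close> below.\<close>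

lemma tempered_dist_finite_order:
  fixes \<omega> :: "'n::finite tempered_dist"
  obtains N :: nat where "\<And>\<psi>. \<bar>pairing \<omega> \<psi>\<bar> \<le> real N * schwartz_norm N \<psi>"
proof -
  let ?U = "pairing \<omega> -` {-1<..<1}"
  have "open ?U" "0 \<in> ?U"
    using pairing_continuous[of \<omega>] linear_0[OF pairing_linear[of \<omega>]]
    by (auto simp: continuous_on_open_vimage)
  then obtain M e where "e > 0"
      and small: "\<And>\<psi>. schwartz_norm M \<psi> < e \<Longrightarrow> \<psi> \<in> ?U"
    by (rule schwartz_nhd_zero) blast
  obtain N0 :: nat where N0: "2 / e \<le> real N0"
    using real_arch_simple by blast
  define N where "N = max M N0"
  have "\<bar>pairing \<omega> \<psi>\<bar> \<le> real N * schwartz_norm N \<psi>" for \<psi>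
  proof -
    have bound: "\<bar>c\<bar> * \<bar>pairing \<omega> \<psi>\<bar> < 1" if "\<bar>c\<bar> * schwartz_norm M \<psi> < e" for c
    proof -
      have "c *\<^sub>R \<psi> \<in> ?U"
        using that schwartz_norm_scale_le[of M c \<psi>] by (intro small) simp
      then have "\<bar>c * pairing \<omega> \<psi>\<bar> < 1"
        by (auto simp: linear_scale[OF pairing_linear])
      then show ?thesis
        by (simp add: abs_mult)
    qed
    have "\<bar>pairing \<omega> \<psi>\<bar> \<le> 2 / e * schwartz_norm M \<psi>"
    proof (cases "schwartz_norm M \<psi> = 0")
      case True
      have "\<bar>pairing \<omega> \<psi>\<bar> = 0"
      proof (rule ccontr)
        assume "\<bar>pairing \<omega> \<psi>\<bar> \<noteq> 0"
        then show False
          using bound[of "1 / \<bar>pairing \<omega> \<psi>\<bar>"] True \<open>e > 0\<close> by simp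
      qed
      then show ?thesis
        using True by simp
    next
      case False
      then have pos: "schwartz_norm M \<psi> > 0"
        using schwartz_norm_nonneg[of M \<psi>] by simp
      then show ?thesis
        using bound[of "e / (2 * schwartz_norm M \<psi>)"] \<open>e > 0\<close> by (simp add: field_simps)
    qed
    also have "\<dots> \<le> real N * schwartz_norm N \<psi>"
      using N0 \<open>e > 0\<close> schwartz_norm_nonneg[of M \<psi>]
      by (intro mult_mono schwartz_norm_mono) (auto simp: N_def)
    finally show ?thesis .
  qed
  then show ?thesis
    using that by blast
qed

definition order_ball :: "nat \<Rightarrow> 'n::finite tempered_dist set" where
  "order_ball N = {\<omega>. \<forall>\<psi>. \<bar>pairing \<omega> \<psi>\<bar> \<le> real N * schwartz_norm N \<psi>}"

text \<open>Finite intersections of cylinders over rational intervals, the candidates for a countable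
  base of the topology on each \<open>order_ball N\<close>.\<close>

definition rational_box :: "(rat \<times> rat \<times> 'n::finite schwartz) list \<Rightarrow> 'n tempered_dist set" where
  "rational_box l =
    {\<omega>. \<forall>(a, b, d)\<in>set l. real_of_rat a < pairing \<omega> d \<and> pairing \<omega> d < real_of_rat b}"

lemma pairing_diff: "pairing \<omega> (\<phi> - \<psi>) = pairing \<omega> \<phi> - pairing \<omega> \<psi>"
  by (rule linear_diff[OF pairing_linear])

text \<open>Countably many test functions decide membership, so that the ball is a countable intersection
  of cylinder sets. The continuity of \<open>\<omega>\<close> is known only at some other order \<open>M\<close>; this is why
  the density of \<open>D\<close> in the larger of the two seminorms is used.\<close>

lemma order_ball_countable:
  fixes D :: "'n::finite schwartz set"
  assumes dense: "\<And>N \<psi> e. e > 0 \<Longrightarrow> \<exists>d\<in>D. schwartz_norm N (\<psi> - d) < e"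
  shows "order_ball N = {\<omega>. \<forall>d\<in>D. \<bar>pairing \<omega> d\<bar> \<le> real N * schwartz_norm N d}"
proof -
  have "\<bar>pairing \<omega> \<psi>\<bar> \<le> real N * schwartz_norm N \<psi>"
    if D: "\<forall>d\<in>D. \<bar>pairing \<omega> d\<bar> \<le> real N * schwartz_norm N d" for \<omega> \<psi>
  proof (rule field_le_epsilon)
    fix e :: real assume "e > 0"
    obtain M where M: "\<And>\<psi>. \<bar>pairing \<omega> \<psi>\<bar> \<le> real M * schwartz_norm M \<psi>"
      using tempered_dist_finite_order[of \<omega>] by blast
    define c where "c = real M + real N + 1"
    obtain d where d: "d \<in> D" "schwartz_norm (max M N) (\<psi> - d) < e / c"
      using dense[of "e / c"] \<open>e > 0\<close> by (auto simp: c_def)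
    then have dM: "schwartz_norm M (\<psi> - d) \<le> e / c" and dN: "schwartz_norm N (\<psi> - d) \<le> e / c"
      using schwartz_norm_mono[of M "max M N" "\<psi> - d"] schwartz_norm_mono[of N "max M N" "\<psi> - d"]
      by simp_all
    have "\<bar>pairing \<omega> \<psi>\<bar> \<le> \<bar>pairing \<omega> d\<bar> + \<bar>pairing \<omega> (\<psi> - d)\<bar>"
      by (simp add: pairing_diff)
    also have "\<dots> \<le> real N * schwartz_norm N d + real M * schwartz_norm M (\<psi> - d)"
      using D d(1) M by (intro add_mono) auto
    also have "\<dots> \<le> real N * (schwartz_norm N \<psi> + e / c) + real M * (e / c)"
      using schwartz_norm_add[of N \<psi> "d - \<psi>"] schwartz_norm_minus[of N \<psi> d] dM dN
      by (intro add_mono mult_left_mono) auto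
    also have "\<dots> = real N * schwartz_norm N \<psi> + (real N + real M) * (e / c)"
      by (simp add: algebra_simps)
    also have "(real N + real M) * (e / c) \<le> c * (e / c)"
      using \<open>e > 0\<close> by (intro mult_right_mono) (auto simp: c_def)
    also have "c * (e / c) = e"
      by (simp add: c_def)
    finally show "\<bar>pairing \<omega> \<psi>\<bar> \<le> real N * schwartz_norm N \<psi> + e"
      by simp
  qed
  then show ?thesis
    unfolding order_ball_def by blast
qed

text \<open>On an equicontinuous set, testing against a dense set of functions already determines the weak-*
  topology, so the weak-* topology restricted to \<open>order_ball N\<close> has a countable base.\<close>

lemma rational_box_neighbourhood:
  fixes D :: "'n::finite schwartz set"
  assumes dense: "\<And>N \<psi> e. e > 0 \<Longrightarrow> \<exists>d\<in>D. schwartz_norm N (\<psi> - d) < e"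
    and "open U" "\<omega> \<in> U" and \<omega>: "\<omega> \<in> order_ball N"
  shows "\<exists>l\<in>lists (UNIV \<times> UNIV \<times> D). \<omega> \<in> rational_box l \<and> rational_box l \<inter> order_ball N \<subseteq> U"
  using assms(2,3) unfolding open_tempered_dist_def
proof (induction rule: generate_topology.induct)
  case UNIV
  show ?case
    by (intro bexI[of _ "[]"]) (auto simp: rational_box_def)
next
  case (Int U V)
  then obtain l l' where "l \<in> lists (UNIV \<times> UNIV \<times> D)" "\<omega> \<in> rational_box l"
      "rational_box l \<inter> order_ball N \<subseteq> U" "l' \<in> lists (UNIV \<times> UNIV \<times> D)"
      "\<omega> \<in> rational_box l'" "rational_box l' \<inter> order_ball N \<subseteq> V"
    by blast
  moreover have "rational_box (l @ l') = rational_box l \<inter> rational_box l'"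
    unfolding rational_box_def set_append ball_Un by blast
  ultimately show ?case
    by (intro bexI[of _ "l @ l'"]) auto
next
  case (UN K)
  then show ?case
    by blast
next
  case (Basis U)
  then obtain \<psi> V where U: "U = (\<lambda>\<omega>. pairing \<omega> \<psi>) -` V" and "open V"
    by blast
  obtain e where "e > 0" and e: "\<And>y. \<bar>y - pairing \<omega> \<psi>\<bar> < e \<Longrightarrow> y \<in> V"
    using \<open>open V\<close> Basis(2) U by (auto simp: open_dist dist_real_def)
  obtain d where d: "d \<in> D" "schwartz_norm N (\<psi> - d) < e / (4 * (real N + 1))"
    using dense[of "e / (4 * (real N + 1))"] \<open>e > 0\<close> by auto
  have near: "\<bar>pairing \<omega>' \<psi> - pairing \<omega>' d\<bar> < e / 4" if "\<omega>' \<in> order_ball N" for \<omega>'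
  proof -
    have "\<bar>pairing \<omega>' (\<psi> - d)\<bar> \<le> real N * schwartz_norm N (\<psi> - d)"
      using that by (auto simp: order_ball_def)
    also have "\<dots> \<le> (real N + 1) * schwartz_norm N (\<psi> - d)"
      by (intro mult_right_mono schwartz_norm_nonneg) auto
    also have "\<dots> < e / 4"
      using d(2) by (simp add: field_simps)
    finally show ?thesis
      by (simp add: pairing_diff)
  qed
  obtain a where a: "pairing \<omega> d - e / 4 < real_of_rat a" "real_of_rat a < pairing \<omega> d"
    using of_rat_dense[of "pairing \<omega> d - e / 4" "pairing \<omega> d"] \<open>e > 0\<close> by auto
  obtain b where b: "pairing \<omega> d < real_of_rat b" "real_of_rat b < pairing \<omega> d + e / 4"
    using of_rat_dense[of "pairing \<omega> d" "pairing \<omega> d + e / 4"] \<open>e > 0\<close> by auto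
  have "rational_box [(a, b, d)] \<inter> order_ball N \<subseteq> U"
  proof
    fix \<omega>' assume "\<omega>' \<in> rational_box [(a, b, d)] \<inter> order_ball N"
    then have "real_of_rat a < pairing \<omega>' d" "pairing \<omega>' d < real_of_rat b"
        "\<bar>pairing \<omega>' \<psi> - pairing \<omega>' d\<bar> < e / 4"
      using near by (auto simp: rational_box_def)
    then have "\<bar>pairing \<omega>' \<psi> - pairing \<omega> \<psi>\<bar> < e"
      using near[OF \<omega>] a b by linarith
    then show "\<omega>' \<in> U"
      using e U by auto
  qed
  moreover have "\<omega> \<in> rational_box [(a, b, d)]"
    using a b by (auto simp: rational_box_def)
  ultimately show ?case
    using d(1) by (intro bexI[of _ "[(a, b, d)]"]) auto
qed

lemma borel_measurable_pairing [measurable]: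
  "(\<lambda>\<omega>. pairing \<omega> \<psi>) \<in> borel_measurable borel"
proof (rule borel_measurable_continuous_onI)
  have "open ((\<lambda>\<omega>. pairing \<omega> \<psi>) -` U)" if "open U" for U
    unfolding open_tempered_dist_def using that by (intro generate_topology.Basis) blast
  then show "continuous_on UNIV (\<lambda>\<omega>. pairing \<omega> \<psi>)"
    by (simp add: continuous_on_open_vimage)
qed

text \<open>The weak-* topology is not second countable, so it is not clear at once that its open sets are generated
  by cylinders with countable operations. But an open set \<open>U\<close> is the union of its intersections with
  the balls \<open>order_ball N\<close>, each of which is a countable union of rational boxes cut down to the
  ball, and the ball itself is a cylinder set.\<close>

lemma sets_borel_tempered_dist:
  "sets (borel :: 'n::finite tempered_dist measure) =
    sigma_sets UNIV {(\<lambda>\<omega>. pairing \<omega> \<psi>) -` A | \<psi> A. A \<in> sets borel}" (is "_ = sigma_sets _ ?G")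
proof -
  define C :: "'n tempered_dist measure" where "C = sigma UNIV ?G"
  have sets_C: "sets C = sigma_sets UNIV ?G" and space_C [simp]: "space C = UNIV"
    unfolding C_def by (auto simp: sets_measure_of space_measure_of)
  have [measurable]: "(\<lambda>\<omega>. pairing \<omega> \<psi>) \<in> borel_measurable C" for \<psi>
  proof (rule measurableI)
    fix A :: "real set" assume "A \<in> sets borel"
    then show "(\<lambda>\<omega>. pairing \<omega> \<psi>) -` A \<inter> space C \<in> sets C"
      unfolding sets_C space_C Int_UNIV_right by (intro sigma_sets.Basic) blast
  qed simp
  obtain D :: "'n schwartz set" where D: "countable D"
      and dense: "\<And>N \<psi> e. e > 0 \<Longrightarrow> \<exists>d\<in>D. schwartz_norm N (\<psi> - d) < e"
    by (rule schwartz_separable) blast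
  have ball: "order_ball N \<in> sets C" for N
  proof -
    have "D \<noteq> {}"
      using dense[OF zero_less_one] by blast
    have "(\<Inter>d\<in>D. {\<omega>\<in>space C. \<bar>pairing \<omega> d\<bar> \<le> real N * schwartz_norm N d}) \<in> sets C"
    proof (rule sets.countable_INT'[OF D \<open>D \<noteq> {}\<close>], rule image_subsetI)
      show "{\<omega>\<in>space C. \<bar>pairing \<omega> d\<bar> \<le> real N * schwartz_norm N d} \<in> sets C" for d
        by measurable
    qed
    also have "(\<Inter>d\<in>D. {\<omega>\<in>space C. \<bar>pairing \<omega> d\<bar> \<le> real N * schwartz_norm N d}) =
        order_ball N"
      using order_ball_countable[OF dense, of N] by auto
    finally show ?thesis .
  qed
  have box: "rational_box l \<in> sets C" for l
  proof -
    have "{\<omega>\<in>space C. \<forall>p\<in>set l. real_of_rat (fst p) < pairing \<omega> (snd (snd p)) \<and>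
        pairing \<omega> (snd (snd p)) < real_of_rat (fst (snd p))} \<in> sets C"
    proof (rule sets.sets_Collect_finite_All)
      show "{\<omega>\<in>space C. real_of_rat (fst p) < pairing \<omega> (snd (snd p)) \<and>
          pairing \<omega> (snd (snd p)) < real_of_rat (fst (snd p))} \<in> sets C" for p
        by measurable
    qed simp
    then show ?thesis
      by (simp add: rational_box_def case_prod_beta)
  qed
  have "U \<in> sets C" if "open U" for U
  proof -
    define I where
      "I N = {l\<in>lists (UNIV \<times> UNIV \<times> D). rational_box l \<inter> order_ball N \<subseteq> U}" for N
    have "countable (I N)" for N
      unfolding I_def using D by (intro countable_Collect countable_lists countable_SIGMA) auto
    then have "(\<Union>N. \<Union>l\<in>I N. rational_box l \<inter> order_ball N) \<in> sets C"
      using ball box by (intro sets.countable_UN sets.countable_UN' image_subsetI sets.Int) auto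
    moreover have "U = (\<Union>N. \<Union>l\<in>I N. rational_box l \<inter> order_ball N)"
    proof (intro equalityI subsetI)
      fix \<omega> assume "\<omega> \<in> U"
      obtain N where N: "\<And>\<psi>. \<bar>pairing \<omega> \<psi>\<bar> \<le> real N * schwartz_norm N \<psi>"
        using tempered_dist_finite_order[of \<omega>] by blast
      then have "\<omega> \<in> order_ball N"
        by (simp add: order_ball_def)
      moreover from this obtain l where "l \<in> I N" "\<omega> \<in> rational_box l"
        using rational_box_neighbourhood[OF dense \<open>open U\<close> \<open>\<omega> \<in> U\<close>, of N] by (auto simp: I_def)
      ultimately show "\<omega> \<in> (\<Union>N. \<Union>l\<in>I N. rational_box l \<inter> order_ball N)"
        by blast
    next
      show "\<omega> \<in> U" if "\<omega> \<in> (\<Union>N. \<Union>l\<in>I N. rational_box l \<inter> order_ball N)" for \<omega>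
        using that by (auto simp: I_def)
    qed
    ultimately show ?thesis
      by simp
  qed
  then have "sets borel \<subseteq> sets C"
    unfolding sets_borel
    using sets.sigma_sets_subset'[of "{U. open U}" C UNIV] sets.top[of C] by auto
  moreover have "sets C \<subseteq> sets borel"
    unfolding sets_C
  proof (rule sets.sigma_sets_subset')
    show "?G \<subseteq> sets borel"
      using measurable_sets[OF borel_measurable_pairing] by auto
  qed simp
  ultimately show ?thesis
    by (simp add: sets_C)
qed

section \<open>Densities with vanishing characteristic function\<close>

lemma borel_measurable_cnj [measurable (raw)]:
  "f \<in> borel_measurable M \<Longrightarrow> (\<lambda>x. cnj (f x)) \<in> borel_measurable M"
  by (rule borel_measurable_continuous_on[of cnj]) (intro continuous_intros)

text \<open>Levy's uniqueness theorem for the signed law of \<open>X\<close> under the density \<open>u\<close>. The condition at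
  \<open>t = 0\<close> says that the positive and the negative part of \<open>u\<close> have the same integral \<open>c\<close>, so after
  division by \<open>c\<close> both give probability laws of \<open>X\<close>, and these have the same characteristic function.\<close>

lemma integral_indicator_zero_of_transform_zero_real:
  fixes u X :: "'a \<Rightarrow> real"
  assumes u: "integrable M u" and X [measurable]: "X \<in> borel_measurable M"
    and zero: "\<And>t. (CLINT x|M. iexp (t * X x) * complex_of_real (u x)) = 0"
    and A [measurable]: "A \<in> sets borel"
  shows "(LINT x|M. indicator A (X x) * u x) = 0"
proof -
  have [measurable]: "u \<in> borel_measurable M"
    using u by auto
  define p where "p x = max 0 (u x)" for x
  define n where "n x = max 0 (- u x)" for x
  have p_int: "integrable M p" and n_int: "integrable M n"
    unfolding p_def n_def using u by (auto intro!: integrable_max)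
  then have [measurable]: "p \<in> borel_measurable M" "n \<in> borel_measurable M"
    by auto
  have pn: "u x = p x - n x" "0 \<le> p x" "0 \<le> n x" for x
    by (auto simp: p_def n_def)
  define c where "c = integral\<^sup>L M p"
  have "complex_of_real (integral\<^sup>L M u) = 0"
    using zero[of 0] by simp
  moreover have "integral\<^sup>L M u = integral\<^sup>L M p - integral\<^sup>L M n"
    using p_int n_int Bochner_Integration.integral_diff[of M p n] by (simp flip: pn(1))
  ultimately have c_n: "integral\<^sup>L M n = c"
    unfolding c_def by simp
  have "c \<ge> 0"
    unfolding c_def by (intro integral_nonneg_AE) (auto simp: pn)
  show ?thesis
  proof (cases "c = 0")
    case True
    have "AE x in M. p x = 0" "AE x in M. n x = 0"
      using integral_nonneg_eq_0_iff_AE[OF p_int] integral_nonneg_eq_0_iff_AE[OF n_int]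
        c_n True pn(2,3) by (auto simp: c_def)
    then have "AE x in M. indicator A (X x) * u x = 0"
      by eventually_elim (simp add: pn(1))
    then show ?thesis
      by (rule integral_eq_zero_AE)
  next
    case False
    then have "c > 0"
      using \<open>c \<ge> 0\<close> by simp
    define law where
      "law q = distr (density M (\<lambda>x. ennreal (q x / c))) borel X" for q :: "'a \<Rightarrow> real"
    have law: "real_distribution (law q)"
        "char (law q) t = (CLINT x|M. iexp (t * X x) * complex_of_real (q x)) / c"
        "measure (law q) A = (LINT x|M. indicator A (X x) * q x) / c"
      if q: "integrable M q" "\<And>x. 0 \<le> q x" "integral\<^sup>L M q = c" for q t
    proof -
      have [measurable]: "q \<in> borel_measurable M"
        using q(1) by auto
      have "prob_space (density M (\<lambda>x. ennreal (q x / c)))"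
      proof (rule prob_spaceI)
        have "emeasure (density M (\<lambda>x. ennreal (q x / c))) (space M) = (\<integral>\<^sup>+x. ennreal (q x / c) \<partial>M)"
          by (subst emeasure_density) (auto intro!: nn_integral_cong)
        also have "\<dots> = ennreal (LINT x|M. q x / c)"
          using q \<open>c > 0\<close> by (intro nn_integral_eq_integral) auto
        also have "\<dots> = 1"
          using q(3) \<open>c > 0\<close> by simp
        finally show "emeasure (density M (\<lambda>x. ennreal (q x / c)))
            (space (density M (\<lambda>x. ennreal (q x / c)))) = 1"
          by simp
      qed
      then interpret D: prob_space "density M (\<lambda>x. ennreal (q x / c))" .
      show "real_distribution (law q)"
        unfolding law_def by (intro D.real_distribution_distr) simp
      then interpret L: real_distribution "law q" .
      have "char (law q) t = (CLINT x|density M (\<lambda>x. ennreal (q x / c)). iexp (t * X x))"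
        unfolding char_def law_def by (subst integral_distr) auto
      also have "\<dots> = (CLINT x|M. (q x / c) *\<^sub>R iexp (t * X x))"
        using q \<open>c > 0\<close> by (subst integral_density) auto
      also have "\<dots> = (CLINT x|M. (iexp (t * X x) * complex_of_real (q x)) / c)"
        by (intro Bochner_Integration.integral_cong) (auto simp: scaleR_conv_of_real)
      finally show "char (law q) t = (CLINT x|M. iexp (t * X x) * complex_of_real (q x)) / c"
        by simp
      have "measure (law q) A = (LINT x|law q. indicator A x)"
        by (simp add: law_def)
      also have "\<dots> = (LINT x|density M (\<lambda>x. ennreal (q x / c)). indicator A (X x))"
        unfolding law_def by (subst integral_distr) auto
      also have "\<dots> = (LINT x|M. (q x / c) *\<^sub>R indicator A (X x))"
        using q \<open>c > 0\<close> by (subst integral_density) auto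
      also have "\<dots> = (LINT x|M. (indicator A (X x) * q x) / c)"
        by (intro Bochner_Integration.integral_cong) auto
      finally show "measure (law q) A = (LINT x|M. indicator A (X x) * q x) / c"
        by simp
    qed
    have prod_int: "integrable M (\<lambda>x. indicator A (X x) * q x)" if q: "integrable M q" for q :: "'a \<Rightarrow> real"
      using q by (rule Bochner_Integration.integrable_bound) (use q in \<open>auto simp: indicator_def\<close>)
    have exp_int: "integrable M (\<lambda>x. iexp (t * X x) * complex_of_real (q x))"
      if q: "integrable M q" for q t
      using q by (rule Bochner_Integration.integrable_bound) (use q in \<open>auto simp: norm_mult\<close>)
    have "char (law p) t = char (law n) t" for t
    proof -
      have "(CLINT x|M. iexp (t * X x) * complex_of_real (p x)) -
          (CLINT x|M. iexp (t * X x) * complex_of_real (n x)) = 0"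
        using zero[of t] exp_int[OF p_int, of t] exp_int[OF n_int, of t]
        by (simp add: pn(1) algebra_simps)
      then show ?thesis
        using law(2)[OF p_int pn(2)] law(2)[OF n_int pn(3)] c_n c_def by simp
    qed
    then have "law p = law n"
      using law(1)[OF p_int pn(2)] law(1)[OF n_int pn(3)] c_n c_def by (intro Levy_uniqueness) auto
    then have "(LINT x|M. indicator A (X x) * p x) = (LINT x|M. indicator A (X x) * n x)"
      using law(3)[OF p_int pn(2)] law(3)[OF n_int pn(3)] c_n c_def \<open>c > 0\<close> by simp
    then show ?thesis
      using prod_int[OF p_int] prod_int[OF n_int] by (simp add: pn(1) right_diff_distrib)
  qed
qed

text \<open>The conjugate of \<open>h\<close> satisfies the same hypothesis, since \<open>t\<close> may be replaced by \<open>-t\<close>; hence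
  so do the real and the imaginary part of \<open>h\<close>.\<close>

lemma integral_indicator_zero_of_transform_zero:
  fixes h :: "'a \<Rightarrow> complex" and X :: "'a \<Rightarrow> real"
  assumes h: "integrable M h" and X [measurable]: "X \<in> borel_measurable M"
    and zero: "\<And>t. (CLINT x|M. iexp (t * X x) * h x) = 0"
    and A [measurable]: "A \<in> sets borel"
  shows "(CLINT x|M. indicator A (X x) * h x) = 0"
proof -
  have [measurable]: "h \<in> borel_measurable M"
    using h by auto
  have int: "integrable M (\<lambda>x. iexp (t * X x) * h x)"
    and cint: "integrable M (\<lambda>x. iexp (t * X x) * cnj (h x))" for t
    using h by (rule Bochner_Integration.integrable_bound; auto simp: norm_mult)+
  have czero: "(CLINT x|M. iexp (t * X x) * cnj (h x)) = 0" for t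
  proof -
    have "(CLINT x|M. iexp (t * X x) * cnj (h x)) = (CLINT x|M. cnj (iexp (- t * X x) * h x))"
      by (intro Bochner_Integration.integral_cong) (auto simp: exp_cnj)
    also have "\<dots> = 0"
      using zero[of "- t"] unfolding Bochner_Integration.integral_cnj by simp
    finally show ?thesis .
  qed
  have "(LINT x|M. indicator A (X x) * Re (h x)) = 0"
  proof (rule integral_indicator_zero_of_transform_zero_real[OF _ X _ A])
    show "(CLINT x|M. iexp (t * X x) * complex_of_real (Re (h x))) = 0" for t
    proof -
      have "(CLINT x|M. iexp (t * X x) * complex_of_real (Re (h x))) =
          (CLINT x|M. (iexp (t * X x) * h x + iexp (t * X x) * cnj (h x)) / 2)"
        by (intro Bochner_Integration.integral_cong refl)
          (simp only: distrib_left[symmetric] complex_add_cnj, simp)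
      also have "\<dots> = 0"
        using zero[of t] czero[of t] int[of t] cint[of t] by simp
      finally show ?thesis .
    qed
  qed (use h in auto)
  moreover have "(LINT x|M. indicator A (X x) * Im (h x)) = 0"
  proof (rule integral_indicator_zero_of_transform_zero_real[OF _ X _ A])
    show "(CLINT x|M. iexp (t * X x) * complex_of_real (Im (h x))) = 0" for t
    proof -
      have "(CLINT x|M. iexp (t * X x) * complex_of_real (Im (h x))) =
          (CLINT x|M. (iexp (t * X x) * h x - iexp (t * X x) * cnj (h x)) / (2 * \<i>))"
        by (intro Bochner_Integration.integral_cong refl)
          (simp only: right_diff_distrib[symmetric] complex_diff_cnj, simp add: mult_ac)
      also have "\<dots> = 0"
        using zero[of t] czero[of t] int[of t] cint[of t] by simp
      finally show ?thesis .
    qed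
  qed (use h in auto)
  moreover have "integrable M (\<lambda>x. indicator A (X x) * h x)"
    using h by (rule Bochner_Integration.integrable_bound) (auto simp: norm_mult indicator_def)
  then have "Re (CLINT x|M. indicator A (X x) * h x) = (LINT x|M. indicator A (X x) * Re (h x))"
    "Im (CLINT x|M. indicator A (X x) * h x) = (LINT x|M. indicator A (X x) * Im (h x))"
    by (auto simp: integral_Re[symmetric] integral_Im[symmetric] indicator_def
        intro!: Bochner_Integration.integral_cong simp del: integral_Re integral_Im)
  ultimately show ?thesis
    by (simp add: complex_eq_iff)
qed

section \<open>Square integrable functions\<close>

lemma L2_add:
  assumes "f \<in> L2 M" "g \<in> L2 M"
  shows "(\<lambda>x. f x + g x) \<in> L2 M"
proof -
  have [measurable]: "f \<in> borel_measurable M" "g \<in> borel_measurable M"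
    using assms by (auto simp: L2_def)
  have "(cmod (f x + g x))\<^sup>2 \<le> 2 * (cmod (f x))\<^sup>2 + 2 * (cmod (g x))\<^sup>2" for x
  proof -
    have "(cmod (f x + g x))\<^sup>2 \<le> (cmod (f x) + cmod (g x))\<^sup>2"
      by (intro power_mono norm_triangle_ineq) auto
    also have "\<dots> \<le> 2 * (cmod (f x))\<^sup>2 + 2 * (cmod (g x))\<^sup>2"
      using sum_squares_bound[of "cmod (f x)" "cmod (g x)"] by (simp add: power2_sum)
    finally show ?thesis .
  qed
  moreover have "integrable M (\<lambda>x. 2 * (cmod (f x))\<^sup>2 + 2 * (cmod (g x))\<^sup>2)"
    using assms by (auto simp: L2_def)
  ultimately have "integrable M (\<lambda>x. (cmod (f x + g x))\<^sup>2)"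
    by (intro Bochner_Integration.integrable_bound[
          where f = "\<lambda>x. 2 * (cmod (f x))\<^sup>2 + 2 * (cmod (g x))\<^sup>2"
            and g = "\<lambda>x. (cmod (f x + g x))\<^sup>2"]) auto
  then show ?thesis
    by (simp add: L2_def)
qed

lemma L2_scale: "f \<in> L2 M \<Longrightarrow> (\<lambda>x. c * f x) \<in> L2 M"
  by (auto simp: L2_def norm_mult power_mult_distrib)

lemma L2_diff: "f \<in> L2 M \<Longrightarrow> g \<in> L2 M \<Longrightarrow> (\<lambda>x. f x - g x) \<in> L2 M"
  using L2_add[of f M "\<lambda>x. -1 * g x"] L2_scale[of g M "-1"] by simp

lemma L2_mult_cnj_integrable:
  assumes "f \<in> L2 M" "g \<in> L2 M"
  shows "integrable M (\<lambda>x. f x * cnj (g x))"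
proof (rule Bochner_Integration.integrable_bound)
  show "integrable M (\<lambda>x. (cmod (f x))\<^sup>2 + (cmod (g x))\<^sup>2)"
    using assms by (auto simp: L2_def)
  have [measurable]: "f \<in> borel_measurable M" "g \<in> borel_measurable M"
    using assms by (auto simp: L2_def)
  show "(\<lambda>x. f x * cnj (g x)) \<in> borel_measurable M"
    by measurable
  have "cmod (f x * cnj (g x)) \<le> (cmod (f x))\<^sup>2 + (cmod (g x))\<^sup>2" for x
    using sum_squares_bound[of "cmod (f x)" "cmod (g x)"]
      mult_nonneg_nonneg[OF norm_ge_zero norm_ge_zero, of "f x" "g x"]
    unfolding norm_mult complex_mod_cnj by linarith
  then show "AE x in M. norm (f x * cnj (g x)) \<le> norm ((cmod (f x))\<^sup>2 + (cmod (g x))\<^sup>2)"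
    by auto
qed

definition L2_inner :: "'a measure \<Rightarrow> ('a \<Rightarrow> complex) \<Rightarrow> ('a \<Rightarrow> complex) \<Rightarrow> complex" where
  "L2_inner M f g = (\<integral>x. f x * cnj (g x) \<partial>M)"

lemma L2_inner_self: "L2_inner M f f = of_real ((L2_norm M f)\<^sup>2)"
proof -
  have "L2_inner M f f = (CLINT x|M. complex_of_real ((cmod (f x))\<^sup>2))"
    unfolding L2_inner_def
    by (intro Bochner_Integration.integral_cong) (auto simp flip: complex_norm_square)
  also have "\<dots> = of_real (LINT x|M. (cmod (f x))\<^sup>2)"
    by (rule integral_complex_of_real)
  finally show ?thesis
    by (simp add: L2_norm_def integral_nonneg_AE)
qed

lemma (in prob_space) L2_integrable:
  assumes "f \<in> L2 M"
  shows "integrable M f"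
  using L2_mult_cnj_integrable[OF assms, of "\<lambda>_. 1"] by (simp add: L2_def)

text \<open>Integrate the pointwise inequality \<open>2 |f| \<le> e + |f|\<^sup>2 / e\<close>; the total mass is 1.\<close>

lemma (in prob_space) L1_norm_less_of_L2_norm_less:
  assumes f: "f \<in> L2 M" and "L2_norm M f < e"
  shows "(LINT x|M. cmod (f x)) < e"
proof -
  have "0 \<le> L2_norm M f"
    by (simp add: L2_norm_def integral_nonneg_AE)
  with assms(2) have "e > 0" and sq: "(L2_norm M f)\<^sup>2 < e\<^sup>2"
    by (auto intro: power_strict_mono)
  have int: "integrable M (\<lambda>x. (cmod (f x))\<^sup>2)"
    using f by (simp add: L2_def)
  have "(LINT x|M. cmod (f x)) \<le> (LINT x|M. e / 2 + (cmod (f x))\<^sup>2 / (2 * e))"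
  proof (rule integral_mono)
    show "cmod (f x) \<le> e / 2 + (cmod (f x))\<^sup>2 / (2 * e)" for x
      using sum_squares_bound[of e "cmod (f x)"] \<open>e > 0\<close>
      by (simp add: field_simps power2_eq_square)
  qed (use L2_integrable[OF f] int in auto)
  also have "\<dots> = e / 2 + (L2_norm M f)\<^sup>2 / (2 * e)"
    using int by (simp add: L2_norm_def integral_nonneg_AE prob_space)
  also have "\<dots> < e / 2 + e\<^sup>2 / (2 * e)"
    using sq \<open>e > 0\<close> by (intro add_strict_left_mono divide_strict_right_mono) auto
  also have "\<dots> = e"
    using \<open>e > 0\<close> by (simp add: power2_eq_square)
  finally show ?thesis .
qed

text \<open>The Riesz-Fischer theorem. On a probability space an L2-Cauchy sequence is Cauchy in L1, so a subsequence
  converges almost everywhere; Fatou's lemma turns the Cauchy estimate into an estimate for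
  the distance to the limit.\<close>

lemma (in prob_space) L2_complete:
  assumes s: "\<And>m. s m \<in> L2 M"
    and cauchy: "\<And>e. e > 0 \<Longrightarrow> \<exists>N. \<forall>m\<ge>N. \<forall>n\<ge>N. L2_norm M (\<lambda>x. s m x - s n x) < e"
  shows "\<exists>f\<in>L2 M. (\<lambda>m. L2_norm M (\<lambda>x. s m x - f x)) \<longlonglongrightarrow> 0"
proof -
  have [measurable]: "s m \<in> borel_measurable M" for m
    using s[of m] by (simp add: L2_def)
  obtain r where r: "strict_mono r" and "AE x in M. Cauchy (\<lambda>i. s (r i) x)"
  proof (rule cauchy_L1_AE_cauchy_subseq[of M s])
    show "integrable M (s n)" for n
      by (rule L2_integrable[OF s])
    show "\<exists>N. \<forall>i\<ge>N. \<forall>j\<ge>N. (LINT x|M. norm (s i x - s j x)) < e" if "e > 0" for e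
      using cauchy[OF that] L1_norm_less_of_L2_norm_less[OF L2_diff[OF s s]] by meson
  qed
  define f where "f x = lim (\<lambda>i. s (r i) x)" for x
  have lim: "AE x in M. (\<lambda>i. s (r i) x) \<longlonglongrightarrow> f x"
    using \<open>AE x in M. Cauchy (\<lambda>i. s (r i) x)\<close>
    by eventually_elim (simp add: f_def Cauchy_convergent convergent_LIMSEQ_iff[symmetric])
  have [measurable]: "f \<in> borel_measurable M"
    unfolding f_def by measurable
  have close: "\<exists>N. \<forall>m\<ge>N. integrable M (\<lambda>x. (cmod (s m x - f x))\<^sup>2) \<and>
      L2_norm M (\<lambda>x. s m x - f x) \<le> e" if "e > 0" for e
  proof -
    obtain N where N: "\<And>m n. m \<ge> N \<Longrightarrow> n \<ge> N \<Longrightarrow> L2_norm M (\<lambda>x. s m x - s n x) < e"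
      using cauchy[OF \<open>e > 0\<close>] by blast
    have "integrable M (\<lambda>x. (cmod (s m x - f x))\<^sup>2) \<and> L2_norm M (\<lambda>x. s m x - f x) \<le> e"
      if "m \<ge> N" for m
    proof -
      have le: "(\<integral>\<^sup>+x. ennreal ((cmod (s m x - s (r i) x))\<^sup>2) \<partial>M) \<le> ennreal (e\<^sup>2)"
        if "i \<ge> N" for i
      proof -
        have int: "integrable M (\<lambda>x. (cmod (s m x - s (r i) x))\<^sup>2)"
          using L2_diff[OF s s, of m "r i"] by (simp add: L2_def)
        have "(LINT x|M. (cmod (s m x - s (r i) x))\<^sup>2) = (L2_norm M (\<lambda>x. s m x - s (r i) x))\<^sup>2"
          by (simp add: L2_norm_def integral_nonneg_AE)
        also have "\<dots> \<le> e\<^sup>2"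
          using N[OF \<open>m \<ge> N\<close>, of "r i"] seq_suble[OF r, of i] that
          by (intro power_mono) (auto simp: L2_norm_def integral_nonneg_AE)
        finally show ?thesis
          using nn_integral_eq_integral[OF int] by (simp add: ennreal_leI)
      qed
      have "(\<integral>\<^sup>+x. ennreal ((cmod (s m x - f x))\<^sup>2) \<partial>M) =
          (\<integral>\<^sup>+x. liminf (\<lambda>i. ennreal ((cmod (s m x - s (r i) x))\<^sup>2)) \<partial>M)"
      proof (rule nn_integral_cong_AE)
        show "AE x in M. ennreal ((cmod (s m x - f x))\<^sup>2) =
            liminf (\<lambda>i. ennreal ((cmod (s m x - s (r i) x))\<^sup>2))"
          using lim
        proof eventually_elim
          case (elim x)
          then have "(\<lambda>i. ennreal ((cmod (s m x - s (r i) x))\<^sup>2)) \<longlonglongrightarrow>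
              ennreal ((cmod (s m x - f x))\<^sup>2)"
            by (intro tendsto_intros)
          then show ?case
            using lim_imp_Liminf[OF sequentially_bot] by metis
        qed
      qed
      also have "\<dots> \<le> liminf (\<lambda>i. \<integral>\<^sup>+x. ennreal ((cmod (s m x - s (r i) x))\<^sup>2) \<partial>M)"
        by (intro nn_integral_liminf) measurable
      also have "\<dots> \<le> liminf (\<lambda>i. ennreal (e\<^sup>2))"
        using le by (intro Liminf_mono) (auto simp: eventually_sequentially)
      also have "\<dots> = ennreal (e\<^sup>2)"
        by (simp add: Liminf_const)
      finally have *: "(\<integral>\<^sup>+x. ennreal ((cmod (s m x - f x))\<^sup>2) \<partial>M) \<le> ennreal (e\<^sup>2)" .
      then have int: "integrable M (\<lambda>x. (cmod (s m x - f x))\<^sup>2)"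
        by (intro integrableI_bounded) (auto intro: le_less_trans)
      have "(LINT x|M. (cmod (s m x - f x))\<^sup>2) \<le> e\<^sup>2"
        using * nn_integral_eq_integral[OF int] by (simp add: ennreal_le_iff)
      then show ?thesis
        using int \<open>e > 0\<close> unfolding L2_norm_def by (simp add: real_le_lsqrt)
    qed
    then show ?thesis
      by blast
  qed
  obtain N where "integrable M (\<lambda>x. (cmod (s N x - f x))\<^sup>2)"
    using close[OF zero_less_one] by blast
  then have "(\<lambda>x. s N x - f x) \<in> L2 M"
    by (simp add: L2_def)
  from L2_diff[OF s this, of N] have "f \<in> L2 M"
    by simp
  moreover have "(\<lambda>m. L2_norm M (\<lambda>x. s m x - f x)) \<longlonglongrightarrow> 0"
  proof (rule LIMSEQ_I)
    fix e :: real assume "e > 0"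
    then obtain N where "\<forall>m\<ge>N. L2_norm M (\<lambda>x. s m x - f x) \<le> e / 2"
      using close[of "e / 2"] by auto
    then show "\<exists>N. \<forall>m\<ge>N. norm (L2_norm M (\<lambda>x. s m x - f x) - 0) < e"
      using \<open>e > 0\<close> by (force simp: L2_norm_def integral_nonneg_AE)
  qed
  ultimately show ?thesis
    by blast
qed

section \<open>The transform\<close>

locale tempered_prob_space = prob_space \<mu> for \<mu> :: "'n::finite tempered_dist measure" +
  assumes sets_\<mu>: "sets \<mu> = sets borel"
begin

lemma pairing_measurable [measurable]: "(\<lambda>\<omega>. pairing \<omega> \<psi>) \<in> borel_measurable \<mu>"
  using borel_measurable_pairing[of \<psi>] measurable_cong_sets[OF sets_\<mu> refl] by blast

text \<open>Call a set \<open>S\<close> annihilated if the integral of \<open>f\<close> times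
  every exponential over \<open>S\<close> vanishes. Keeping all exponentials in this condition is the
  point: for a single test function \<open>\<phi>\<close>, multiplication by \<open>exp (\<i> t \<langle>\<omega>, \<phi>\<rangle>)\<close> only shifts the exponential, so
  the one-dimensional uniqueness theorem shows that annihilated sets stay annihilated when they
  are intersected with cylinders over \<open>\<phi>\<close>. The sets that preserve annihilation under intersection form a
  sigma-algebra, so they include all Borel sets.\<close>

lemma exponentials_total_L1:
  assumes f: "integrable \<mu> f"
    and zero: "\<And>\<psi>. (CLINT \<omega>|\<mu>. iexp (pairing \<omega> \<psi>) * f \<omega>) = 0"
  shows "AE \<omega> in \<mu>. f \<omega> = 0"
proof -
  have space_\<mu> [simp]: "space \<mu> = UNIV"
    using sets_eq_imp_space_eq[OF sets_\<mu>] by simp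
  have [measurable]: "f \<in> borel_measurable \<mu>"
    using f by auto
  let ?g = "\<lambda>\<psi> \<omega>. iexp (pairing \<omega> \<psi>) * f \<omega>"
  have int: "integrable \<mu> (\<lambda>\<omega>. indicator S \<omega> * ?g \<psi> \<omega>)" if [measurable]: "S \<in> sets \<mu>" for S \<psi>
    using f by (rule Bochner_Integration.integrable_bound) (auto simp: norm_mult indicator_def)
  define ann where
    "ann S \<longleftrightarrow> S \<in> sets \<mu> \<and> (\<forall>\<psi>. (CLINT \<omega>|\<mu>. indicator S \<omega> * ?g \<psi> \<omega>) = 0)" for S
  have ann_diff: "ann (S - T)" if "ann S" "ann T" "T \<subseteq> S" for S T
  proof -
    have ind: "indicator (S - T) \<omega> * z = indicator S \<omega> * z - indicator T \<omega> * z" for \<omega> and z :: complex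
      using \<open>T \<subseteq> S\<close> by (auto simp: indicator_def)
    show ?thesis
      using that int[of S] int[of T] by (auto simp: ann_def ind)
  qed
  have inter: "\<forall>S. ann S \<longrightarrow> ann (S \<inter> B)"
    if "B \<in> sigma_sets UNIV {(\<lambda>\<omega>. pairing \<omega> \<psi>) -` A | \<psi> A. A \<in> sets borel}" for B
    using that
  proof induction
    case (Basic B)
    then obtain \<phi> A where B: "B = (\<lambda>\<omega>. pairing \<omega> \<phi>) -` A" and [measurable]: "A \<in> sets borel"
      by blast
    have [measurable]: "B \<in> sets \<mu>"
      using measurable_sets[of "\<lambda>\<omega>. pairing \<omega> \<phi>" \<mu> borel A] by (simp add: B)
    have "(CLINT \<omega>|\<mu>. indicator (S \<inter> B) \<omega> * ?g \<psi> \<omega>) = 0" if S: "ann S" for S \<psi>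
    proof -
      have [measurable]: "S \<in> sets \<mu>"
        using S by (simp add: ann_def)
      have "(CLINT \<omega>|\<mu>. indicator A (pairing \<omega> \<phi>) * (indicator S \<omega> * ?g \<psi> \<omega>)) = 0"
      proof (rule integral_indicator_zero_of_transform_zero)
        show "(CLINT \<omega>|\<mu>. iexp (t * pairing \<omega> \<phi>) * (indicator S \<omega> * ?g \<psi> \<omega>)) = 0" for t
        proof -
          have "(CLINT \<omega>|\<mu>. iexp (t * pairing \<omega> \<phi>) * (indicator S \<omega> * ?g \<psi> \<omega>)) =
              (CLINT \<omega>|\<mu>. indicator S \<omega> * ?g (t *\<^sub>R \<phi> + \<psi>) \<omega>)"
            by (intro Bochner_Integration.integral_cong)
              (auto simp: linear_add[OF pairing_linear] linear_scale[OF pairing_linear]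
                exp_add distrib_left)
          then show ?thesis
            using S by (simp add: ann_def)
        qed
      qed (use int[of S] in auto)
      moreover have "indicator A (pairing \<omega> \<phi>) * (indicator S \<omega> * z) = indicator (S \<inter> B) \<omega> * z"
        for \<omega> and z :: complex
        by (auto simp: B indicator_def)
      ultimately show ?thesis
        by simp
    qed
    then show ?case
      by (auto simp: ann_def)
  next
    case Empty
    then show ?case
      by (simp add: ann_def)
  next
    case (Compl B)
    have "S \<inter> (UNIV - B) = S - S \<inter> B" for S
      by auto
    with Compl.IH ann_diff show ?case
      by simp
  next
    case (Union B)
    show ?case
    proof (intro allI impI)
      fix S assume S: "ann S"
      define U where "U n = S \<inter> (\<Union>i<n. B i)" for n
      have ann_U: "ann (U n)" for n
      proof (induction n)
        case 0
        show ?case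
          by (simp add: U_def ann_def)
      next
        case (Suc n)
        have "U n \<subseteq> S"
          by (auto simp: U_def)
        have rest: "ann (S - U n)"
          using ann_diff[OF S Suc \<open>U n \<subseteq> S\<close>] .
        then have "ann ((S - U n) \<inter> B n)"
          using Union.IH by blast
        then have "ann ((S - U n) - (S - U n) \<inter> B n)"
          by (rule ann_diff[OF rest]) blast
        then have "ann (S - ((S - U n) - (S - U n) \<inter> B n))"
          by (rule ann_diff[OF S]) blast
        \<comment> \<open>Annihilation is stable under proper differences, which express this union.\<close>
        moreover have "S - ((S - U n) - (S - U n) \<inter> B n) = U (Suc n)"
          by (auto simp: U_def less_Suc_eq)
        ultimately show ?case
          by simp
      qed
      then have [measurable]: "U n \<in> sets \<mu>" for n
        by (simp add: ann_def)
      have UN: "S \<inter> (\<Union>i. B i) = (\<Union>n. U n)"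
        by (auto simp: U_def)
      have [measurable]: "S \<inter> (\<Union>i. B i) \<in> sets \<mu>"
        unfolding UN by auto
      have "(CLINT \<omega>|\<mu>. indicator (S \<inter> (\<Union>i. B i)) \<omega> * ?g \<psi> \<omega>) = 0" for \<psi>
      proof -
        have "(\<lambda>n. CLINT \<omega>|\<mu>. indicator (U n) \<omega> * ?g \<psi> \<omega>) \<longlonglongrightarrow>
            (CLINT \<omega>|\<mu>. indicator (S \<inter> (\<Union>i. B i)) \<omega> * ?g \<psi> \<omega>)"
        proof (rule integral_dominated_convergence[where w = "\<lambda>\<omega>. norm (f \<omega>)"])
          have "(\<lambda>n. indicator (U n) \<omega> * ?g \<psi> \<omega>) \<longlonglongrightarrow>
              indicator (S \<inter> (\<Union>i. B i)) \<omega> * ?g \<psi> \<omega>" for \<omega>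
            unfolding U_def indicator_inter_arith
            by (intro tendsto_mult tendsto_const LIMSEQ_indicator_UN)
          then show "AE \<omega> in \<mu>. (\<lambda>n. indicator (U n) \<omega> * ?g \<psi> \<omega>) \<longlonglongrightarrow>
              indicator (S \<inter> (\<Union>i. B i)) \<omega> * ?g \<psi> \<omega>"
            by simp
          show "AE \<omega> in \<mu>. norm (indicator (U n) \<omega> * ?g \<psi> \<omega>) \<le> norm (f \<omega>)" for n
            by (auto simp: norm_mult indicator_def)
        qed (use f in auto)
        then show ?thesis
          using ann_U by (simp add: ann_def LIMSEQ_const_iff)
      qed
      then show "ann (S \<inter> (\<Union>i. B i))"
        by (simp add: ann_def)
    qed
  qed
  show ?thesis
  proof (rule density_zero[OF f])
    fix B assume "B \<in> sets \<mu>"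
    moreover have "ann UNIV"
      using zero sets.top[of \<mu>] by (simp add: ann_def)
    moreover have "B \<in> sigma_sets UNIV {(\<lambda>\<omega>. pairing \<omega> \<psi>) -` A | \<psi> A. A \<in> sets borel}"
      using \<open>B \<in> sets \<mu>\<close> unfolding sets_\<mu> sets_borel_tempered_dist .
    ultimately have "ann (UNIV \<inter> B)"
      using inter by blast
    then have "ann B"
      by simp
    then have "(CLINT \<omega>|\<mu>. indicator B \<omega> * ?g 0 \<omega>) = 0"
      unfolding ann_def by blast
    then show "set_lebesgue_integral \<mu> B f = 0"
      unfolding set_lebesgue_integral_def
      by (simp add: linear_0[OF pairing_linear] indicator_scaleR_eq_if indicator_times_eq_if)
  qed
qed

lemma exp_pairing_L2: "(\<lambda>\<omega>. iexp (pairing \<omega> \<psi>)) \<in> L2 \<mu>"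
  by (simp add: L2_def)

lemma F_transform_eq_inner:
  "F_transform \<mu> f \<psi> = L2_inner \<mu> f (\<lambda>\<omega>. iexp (pairing \<omega> \<psi>))"
  unfolding F_transform_def L2_inner_def
  by (intro Bochner_Integration.integral_cong) (auto simp: exp_cnj)

lemma F_transform_AE_cong:
  assumes "f \<in> L2 \<mu>" "g \<in> L2 \<mu>" "AE \<omega> in \<mu>. f \<omega> = g \<omega>"
  shows "F_transform \<mu> f = F_transform \<mu> g"
proof
  have [measurable]: "f \<in> borel_measurable \<mu>" "g \<in> borel_measurable \<mu>"
    using assms by (auto simp: L2_def)
  show "F_transform \<mu> f \<psi> = F_transform \<mu> g \<psi>" for \<psi>
    unfolding F_transform_def using assms(3) by (intro integral_cong_AE) auto
qed

lemma L2_inner_add: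
  assumes "f \<in> L2 \<mu>" "g \<in> L2 \<mu>" "h \<in> L2 \<mu>"
  shows "L2_inner \<mu> (\<lambda>\<omega>. f \<omega> + g \<omega>) h = L2_inner \<mu> f h + L2_inner \<mu> g h"
  unfolding L2_inner_def using assms by (simp add: distrib_right L2_mult_cnj_integrable)

lemma L2_inner_scale:
  shows "L2_inner \<mu> (\<lambda>\<omega>. c * f \<omega>) h = c * L2_inner \<mu> f h"
  unfolding L2_inner_def by (simp add: mult.assoc)

lemma L2_inner_cnj:
  "L2_inner \<mu> g f = cnj (L2_inner \<mu> f g)"
  unfolding L2_inner_def Bochner_Integration.integral_cnj[symmetric] by (simp add: mult.commute)

lemma F_transform_add:
  "f \<in> L2 \<mu> \<Longrightarrow> g \<in> L2 \<mu> \<Longrightarrow>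
    F_transform \<mu> (\<lambda>\<omega>. f \<omega> + g \<omega>) = (\<lambda>\<psi>. F_transform \<mu> f \<psi> + F_transform \<mu> g \<psi>)"
  by (simp add: fun_eq_iff F_transform_eq_inner L2_inner_add exp_pairing_L2)

lemma F_transform_scale: "F_transform \<mu> (\<lambda>\<omega>. c * f \<omega>) = (\<lambda>\<psi>. c * F_transform \<mu> f \<psi>)"
  by (simp add: fun_eq_iff F_transform_eq_inner L2_inner_scale)

lemma F_transform_diff:
  "f \<in> L2 \<mu> \<Longrightarrow> g \<in> L2 \<mu> \<Longrightarrow>
    F_transform \<mu> (\<lambda>\<omega>. f \<omega> - g \<omega>) = (\<lambda>\<psi>. F_transform \<mu> f \<psi> - F_transform \<mu> g \<psi>)"
  using F_transform_add[of f "\<lambda>\<omega>. -1 * g \<omega>"] F_transform_scale[of "-1" g] L2_scale[of g \<mu> "-1"]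
  by simp

lemma F_transform_zero_imp_AE_zero:
  assumes f: "f \<in> L2 \<mu>" and "F_transform \<mu> f = (\<lambda>_. 0)"
  shows "AE \<omega> in \<mu>. f \<omega> = 0"
proof (rule exponentials_total_L1[OF L2_integrable[OF f]])
  fix \<psi>
  have "(CLINT \<omega>|\<mu>. iexp (pairing \<omega> \<psi>) * f \<omega>) = F_transform \<mu> f (- \<psi>)"
    unfolding F_transform_def by (simp add: linear_neg[OF pairing_linear])
  then show "(CLINT \<omega>|\<mu>. iexp (pairing \<omega> \<psi>) * f \<omega>) = 0"
    using assms(2) by simp
qed

text \<open>The inner product carried over from L2. Which representatives are chosen is immaterial, because two square
  integrable functions with the same transform agree almost everywhere.\<close>

definition transform_inner ::
    "('n schwartz \<Rightarrow> complex) \<Rightarrow> ('n schwartz \<Rightarrow> complex) \<Rightarrow> complex" where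
  "transform_inner h k = L2_inner \<mu>
    (SOME f. f \<in> L2 \<mu> \<and> F_transform \<mu> f = h) (SOME g. g \<in> L2 \<mu> \<and> F_transform \<mu> g = k)"

lemma transform_inner_F_transform:
  assumes f: "f \<in> L2 \<mu>" and g: "g \<in> L2 \<mu>"
  shows "transform_inner (F_transform \<mu> f) (F_transform \<mu> g) = L2_inner \<mu> f g"
proof -
  define r where "r f = (SOME f'. f' \<in> L2 \<mu> \<and> F_transform \<mu> f' = F_transform \<mu> f)" for f
  have r: "r f \<in> L2 \<mu>" "F_transform \<mu> (r f) = F_transform \<mu> f" if "f \<in> L2 \<mu>" for f
    using someI[of "\<lambda>f'. f' \<in> L2 \<mu> \<and> F_transform \<mu> f' = F_transform \<mu> f" f] that
    unfolding r_def by auto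
  have AE_r: "AE \<omega> in \<mu>. r f \<omega> = f \<omega>" if "f \<in> L2 \<mu>" for f
    using F_transform_zero_imp_AE_zero[OF L2_diff[OF r(1)[OF that] that]]
      F_transform_diff[OF r(1)[OF that] that] r(2)[OF that] by simp
  have [measurable]: "f \<in> borel_measurable \<mu>" "g \<in> borel_measurable \<mu>"
      "r f \<in> borel_measurable \<mu>" "r g \<in> borel_measurable \<mu>"
    using f g r(1)[OF f] r(1)[OF g] by (auto simp: L2_def)
  have "L2_inner \<mu> (r f) (r g) = L2_inner \<mu> f g"
    unfolding L2_inner_def using AE_r[OF f] AE_r[OF g] by (intro integral_cong_AE) auto
  then show ?thesis
    by (simp add: transform_inner_def r_def)
qed

lemma transform_sq:
  "f \<in> L2 \<mu> \<Longrightarrow> Re (transform_inner (F_transform \<mu> f) (F_transform \<mu> f)) = (L2_norm \<mu> f)\<^sup>2"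
  by (simp add: transform_inner_F_transform L2_inner_self)

lemma transform_norm:
  "f \<in> L2 \<mu> \<Longrightarrow>
    sqrt (Re (transform_inner (F_transform \<mu> f) (F_transform \<mu> f))) = L2_norm \<mu> f"
  by (simp add: transform_sq) (simp add: L2_norm_def integral_nonneg_AE)

text \<open>The value of a transform at \<open>\<psi>\<close> is the inner product in L2 with the exponential of \<open>\<psi>\<close>. Hence the
  transforms of the exponentials are the kernel functions, and the reproducing property holds.\<close>

lemma reproducing_kernel_space_F_transform:
  assumes K: "\<And>\<phi> \<psi>. K \<phi> \<psi> = F_transform \<mu> (\<lambda>\<omega>. iexp (pairing \<omega> \<psi>)) \<phi>"
  shows "reproducing_kernel_space (F_transform \<mu> ` L2 \<mu>) transform_inner K"
proof
  let ?H = "F_transform \<mu> ` L2 \<mu>"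
  note inner = transform_inner_F_transform
  show "(\<lambda>x. 0) \<in> ?H"
    using F_transform_scale[of 0 "\<lambda>_. 0"] by (intro image_eqI[of _ _ "\<lambda>_. 0"]) (auto simp: L2_def)
  show add: "(\<lambda>x. f x + g x) \<in> ?H" if "f \<in> ?H" "g \<in> ?H" for f g
    using that by (auto simp flip: F_transform_add intro!: imageI L2_add)
  show scale: "(\<lambda>x. c * f x) \<in> ?H" if "f \<in> ?H" for f c
    using that by (auto simp flip: F_transform_scale intro!: imageI L2_scale)
  show "transform_inner (\<lambda>x. f x + g x) h = transform_inner f h + transform_inner g h"
    if "f \<in> ?H" "g \<in> ?H" "h \<in> ?H" for f g h
    using that by (auto simp: inner L2_inner_add L2_add simp flip: F_transform_add)
  show "transform_inner (\<lambda>x. c * f x) h = c * transform_inner f h" if "f \<in> ?H" "h \<in> ?H" for f h c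
    using that by (auto simp: inner L2_inner_scale L2_scale simp flip: F_transform_scale)
  show "transform_inner g f = cnj (transform_inner f g)" if "f \<in> ?H" "g \<in> ?H" for f g
  proof -
    from that obtain u v where "u \<in> L2 \<mu>" "v \<in> L2 \<mu>" "f = F_transform \<mu> u" "g = F_transform \<mu> v"
      by blast
    then show ?thesis
      using L2_inner_cnj[of v u] by (simp add: inner)
  qed
  show "0 \<le> Re (transform_inner f f)" if "f \<in> ?H" for f
    using that by (auto simp: transform_sq)
  show "f = (\<lambda>x. 0)" if "f \<in> ?H" "transform_inner f f = 0" for f
  proof -
    from that(1) obtain u where u: "u \<in> L2 \<mu>" "f = F_transform \<mu> u"
      by blast
    then have "(L2_norm \<mu> u)\<^sup>2 = 0"
      using that(2) transform_sq[OF u(1)] by (simp add: u(2))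
    then have "(LINT \<omega>|\<mu>. (cmod (u \<omega>))\<^sup>2) = 0"
      by (simp add: L2_norm_def)
    then have "AE \<omega> in \<mu>. u \<omega> = 0"
      using u(1) integral_nonneg_eq_0_iff_AE[of \<mu> "\<lambda>\<omega>. (cmod (u \<omega>))\<^sup>2"] by (simp add: L2_def)
    then show ?thesis
      using F_transform_AE_cong[OF u(1), of "\<lambda>_. 0"] u F_transform_scale[of 0 "\<lambda>_. 0"]
      by (simp add: L2_def)
  qed
  show "\<exists>f\<in>?H. (\<lambda>m. sqrt (Re (transform_inner (\<lambda>x. s m x - f x) (\<lambda>x. s m x - f x)))) \<longlonglongrightarrow> 0"
    if s: "\<And>m. s m \<in> ?H"
      and cauchy: "\<And>e. e > 0 \<Longrightarrow> \<exists>N. \<forall>m\<ge>N. \<forall>n\<ge>N.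
        sqrt (Re (transform_inner (\<lambda>x. s m x - s n x) (\<lambda>x. s m x - s n x))) < e" for s
  proof -
    have "\<forall>m. \<exists>u\<in>L2 \<mu>. s m = F_transform \<mu> u"
      using s by blast
    then obtain u where u: "\<And>m. u m \<in> L2 \<mu>" "\<And>m. s m = F_transform \<mu> (u m)"
      by metis
    have dist: "sqrt (Re (transform_inner (\<lambda>x. s m x - F_transform \<mu> g x)
        (\<lambda>x. s m x - F_transform \<mu> g x))) = L2_norm \<mu> (\<lambda>\<omega>. u m \<omega> - g \<omega>)" if "g \<in> L2 \<mu>" for m g
      using transform_norm[OF L2_diff[OF u(1) that], of m] F_transform_diff[OF u(1) that, of m]
      by (simp add: u(2))
    have "\<exists>f\<in>L2 \<mu>. (\<lambda>m. L2_norm \<mu> (\<lambda>x. u m x - f x)) \<longlonglongrightarrow> 0"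
    proof (rule L2_complete[OF u(1)])
      fix e :: real assume "e > 0"
      show "\<exists>N. \<forall>m\<ge>N. \<forall>n\<ge>N. L2_norm \<mu> (\<lambda>\<omega>. u m \<omega> - u n \<omega>) < e"
        using cauchy[OF \<open>e > 0\<close>] unfolding dist[OF u(1), folded u(2)] .
    qed
    then obtain f where f: "f \<in> L2 \<mu>" "(\<lambda>m. L2_norm \<mu> (\<lambda>x. u m x - f x)) \<longlonglongrightarrow> 0"
      by blast
    show ?thesis
      by (rule bexI[of _ "F_transform \<mu> f"]) (use f in \<open>simp_all only: dist imageI\<close>)
  qed
  show kernel: "(\<lambda>x. K x y) \<in> ?H" for y
    unfolding K using exp_pairing_L2[of y] by auto
  show "f y = transform_inner f (\<lambda>x. K x y)" if "f \<in> ?H" for f y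
  proof -
    from that obtain u where u: "u \<in> L2 \<mu>" "f = F_transform \<mu> u"
      by blast
    show ?thesis
      unfolding K u(2) inner[OF u(1) exp_pairing_L2] by (rule F_transform_eq_inner)
  qed
qed

end

theorem theorem6p1:
  fixes \<sigma> :: "(real^'n::finite) measure"
    and \<mu> :: "'n tempered_dist measure"
  assumes "\<sigma> \<in> class_C"
    and "is_mu \<sigma> \<mu>"
  shows "(\<forall>f\<in>L2 \<mu>. \<forall>g\<in>L2 \<mu>.
            (AE \<omega> in \<mu>. f \<omega> = g \<omega>) \<longrightarrow> F_transform \<mu> f = F_transform \<mu> g) \<and>
         (\<forall>f\<in>L2 \<mu>. \<forall>g\<in>L2 \<mu>. \<forall>a b.
            F_transform \<mu> (\<lambda>\<omega>. a * f \<omega> + b * g \<omega>) =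
            (\<lambda>\<psi>. a * F_transform \<mu> f \<psi> + b * F_transform \<mu> g \<psi>)) \<and>
         (\<forall>f\<in>L2 \<mu>. rkhs_norm (C_kernel \<sigma>) (F_transform \<mu> f) = L2_norm \<mu> f) \<and>
         F_transform \<mu> ` L2 \<mu> = rkhs (C_kernel \<sigma>)"
proof -
  interpret prob_space \<mu>
    using assms(2) by (simp add: is_mu_def)
  interpret tempered_prob_space \<mu>
    using assms(2) by unfold_locales (simp add: is_mu_def)
  have char: "(\<integral>\<omega>. exp (\<i> * of_real (pairing \<omega> \<psi>)) \<partial>\<mu>) = C_fun \<sigma> \<psi>" for \<psi>
    using assms(2) by (simp add: is_mu_def)
  \<comment> \<open>Conjugation turns the characteristic functional at \<open>\<phi> - \<psi>\<close> into the transform of an exponential, and \<open>C_fun\<close> is real.\<close>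
  have K: "C_kernel \<sigma> \<phi> \<psi> = F_transform \<mu> (\<lambda>\<omega>. iexp (pairing \<omega> \<psi>)) \<phi>" for \<phi> \<psi>
  proof -
    have "F_transform \<mu> (\<lambda>\<omega>. iexp (pairing \<omega> \<psi>)) \<phi> =
        (\<integral>\<omega>. cnj (exp (\<i> * of_real (pairing \<omega> (\<phi> - \<psi>)))) \<partial>\<mu>)"
      unfolding F_transform_def
      by (intro Bochner_Integration.integral_cong)
        (auto simp: pairing_diff exp_cnj simp flip: exp_add simp: algebra_simps)
    also have "\<dots> = cnj (C_fun \<sigma> (\<phi> - \<psi>))"
      unfolding Bochner_Integration.integral_cnj char ..
    also have "\<dots> = C_kernel \<sigma> \<phi> \<psi>"
      by (simp add: C_fun_def C_kernel_def)
    finally show ?thesis ..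
  qed
  note rks = reproducing_kernel_space_F_transform[OF K]
  have "F_transform \<mu> (\<lambda>\<omega>. a * f \<omega> + b * g \<omega>) =
      (\<lambda>\<psi>. a * F_transform \<mu> f \<psi> + b * F_transform \<mu> g \<psi>)" if "f \<in> L2 \<mu>" "g \<in> L2 \<mu>" for f g a b
    using F_transform_add[OF L2_scale[OF that(1)] L2_scale[OF that(2)]]
    by (simp add: F_transform_scale)
  moreover have "rkhs_norm (C_kernel \<sigma>) (F_transform \<mu> f) = L2_norm \<mu> f" if "f \<in> L2 \<mu>" for f
    using rkhs_norm_eq[OF rks] transform_norm[OF that] that by simp
  moreover have "F_transform \<mu> ` L2 \<mu> = rkhs (C_kernel \<sigma>)"
    using rkhs_eq[OF rks] ..
  ultimately show ?thesis
    using F_transform_AE_cong by blast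
qed

end
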